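(* Denote by $V^\tau=(V_{t\wedge\tau})_{t\ge0}$ the asset value process stopped at the default boundary, let $\tilde Z_t=\int_0^ta(V^\tau_s)\,ds+W_t$ and $\tilde D_t=\sum_{\{n:t_n\le t\}}\delta_n(V^\tau_{t_n-}-K)^+$, and let $\mathbb{F}^{\tilde Z}=(\mathcal{F}^{\tilde Z}_t)$, $\mathbb{F}^{\tilde D}=(\mathcal{F}^{\tilde D}_t)$ be the filtrations they generate. Then for every measurable $h:[K,\infty)\to\mathbb{R}$ such that $E^Q(|h(V_t)|)<\infty$ for all $t\le T$, and all $t\le T$, $$1_{\{\tau>t\}}E^Q\big(h(V_t)\mid\mathcal{F}^{\mathcal{M}}_t\big)=1_{\{\tau>t\}}\frac{E^Q\big(h(V^\tau_t)1_{\{V^\tau_t>K\}}\mid\mathcal{F}^{\tilde Z}_t\vee\mathcal{F}^{\tilde D}_t\big)}{Q\big(V^\tau_t>K\mid\mathcal{F}^{\tilde Z}_t\vee\mathcal{F}^{\tilde D}_t\big)}.$$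
   Context: Let $(\Omega,\mathcal{G},\mathbb{G}=(\mathcal{G}_t)_{t\ge0},Q)$ be a filtered probability space, $T>0$, $r\ge0$, $\sigma>0$, $K>0$, $\kappa\in\{0,1\}$. Let $B$ be a standard one-dimensional $\mathbb{G}$-Brownian motion and $W$ an $l$-dimensional $\mathbb{G}$-Brownian motion independent of $B$. Dividend dates $0<t_1<t_2<\dots$ are deterministic and equidistant. $(\delta_n)_{n\ge1}$ are i.i.d. with values in $(0,1)$ and density $\varphi_\delta$, which is bounded and twice continuously differentiable on $[0,1]$ with $\varphi_\delta(1)=0$; $\delta_n$ is $\mathcal{G}_{t_n}$-measurable and independent of $\mathcal{G}_{t_n-}$. The asset value process $V$ satisfies $$V_t=V_0+\int_0^trV_sds+\int_0^t\sigma V_sdB_s-\kappa D_t,\qquad D_t=\sum_{\{n:t_n\le t\}}d_n,\qquad d_n=\delta_n(V_{t_n-}-K)^+,$$ where $V_0$ is $\mathcal{G}_0$-measurable with finite second moment and Lebesgue density $\pi_0:[K,\infty)\to\mathbb{R}^+$, continuously differentiable with $\pi_0(K)=0$. The default time is $\tau=\inf\{t\ge0:V_t\le K\}$ and $Y_t=1_{\{\tau\le t\}}$. The function $a:\mathbb{R}^+\to\mathbb{R}^l$ is bounded and continuously differentiable with $a(K)=0$, and $Z_t=\int_0^ta(V_s)ds+W_t$. The modelling filtration is $\mathbb{F}^{\mathcal{M}}=\mathbb{F}^Y\vee\mathbb{F}^D\vee\mathbb{F}^Z$, where $\mathbb{F}^Y,\mathbb{F}^D,\mathbb{F}^Z$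 are the filtrations generated by $Y,D,Z$. The function $h$ is extended by $0$ to arguments below $K$ (this does not affect the values on $\{\tau>t\}$). *)

theory Defs
  imports "HOL-Probability.Probability"
begin

section \<open>Filtrations and generated sigma-algebras\<close>

text \<open>Time is \<open>[0, \<infinity>)\<close>, represented by the nonnegative reals; processes and
  filtrations are functions on all of \<^typ>\<open>real\<close> whose values at negative times are never used.
  Only monotonicity is required of a filtration (no usual conditions).\<close>

definition time_filtration :: "'a measure \<Rightarrow> (real \<Rightarrow> 'a measure) \<Rightarrow> bool" where
  "time_filtration M G \<longleftrightarrow>
     (\<forall>t\<ge>0. subalgebra M (G t)) \<and> (\<forall>s t. 0 \<le> s \<longrightarrow> s \<le> t \<longrightarrow> sets (G s) \<subseteq> sets (G t))"

definition left_sigma :: "'a measure \<Rightarrow> (real \<Rightarrow> 'a measure) \<Rightarrow> real \<Rightarrow> 'a measure" where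
  "left_sigma M G t = sigma (space M) (\<Union>s\<in>{0..<t}. sets (G s))"

definition generated_sigma ::
    "'a measure \<Rightarrow> 'i set \<Rightarrow> ('i \<Rightarrow> 'a \<Rightarrow> 'b::topological_space) \<Rightarrow> 'a measure" where
  "generated_sigma M I X = sigma (space M) {X i -` A \<inter> space M | i A. i \<in> I \<and> A \<in> sets borel}"

abbreviation natural_filtration ::
    "'a measure \<Rightarrow> (real \<Rightarrow> 'a \<Rightarrow> 'b::topological_space) \<Rightarrow> real \<Rightarrow> 'a measure" where
  "natural_filtration M X t \<equiv> generated_sigma M {0..t} X"

definition sigma_join :: "'a measure \<Rightarrow> 'a measure \<Rightarrow> 'a measure \<Rightarrow> 'a measure" where
  "sigma_join M F G = sigma (space M) (sets F \<union> sets G)"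

definition adapted :: "(real \<Rightarrow> 'a measure) \<Rightarrow> (real \<Rightarrow> 'a \<Rightarrow> 'b::topological_space) \<Rightarrow> bool" where
  "adapted G X \<longleftrightarrow> (\<forall>t\<ge>0. X t \<in> borel_measurable (G t))"

definition progressive :: "(real \<Rightarrow> 'a measure) \<Rightarrow> (real \<Rightarrow> 'a \<Rightarrow> 'b::topological_space) \<Rightarrow> bool" where
  "progressive G X \<longleftrightarrow>
     (\<forall>t\<ge>0. (\<lambda>(s, \<omega>). X s \<omega>) \<in> borel_measurable (restrict_space borel {0..t} \<Otimes>\<^sub>M G t))"

definition cadlag :: "'a measure \<Rightarrow> (real \<Rightarrow> 'a \<Rightarrow> 'b::topological_space) \<Rightarrow> bool" where
  "cadlag M X \<longleftrightarrow> (\<forall>\<omega>\<in>space M. \<forall>t\<ge>0.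
     ((\<lambda>s. X s \<omega>) \<longlongrightarrow> X t \<omega>) (at_right t) \<and>
     (0 < t \<longrightarrow> (\<exists>l. ((\<lambda>s. X s \<omega>) \<longlongrightarrow> l) (at_left t))))"

definition left_limit :: "(real \<Rightarrow> 'a \<Rightarrow> 'b::t2_space) \<Rightarrow> real \<Rightarrow> 'a \<Rightarrow> 'b" where
  "left_limit X t \<omega> = Lim (at_left t) (\<lambda>s. X s \<omega>)"


section \<open>Brownian motion and the Ito integral\<close>

text \<open>A standard Brownian motion relative to the filtration \<open>G\<close>, of dimension
  \<open>DIM('b)\<close>: the increment over \<open>[s, t]\<close> is independent of \<open>G s\<close> and has
  the law N(0, (t - s) Id), given by its product density.\<close>

definition brownian_motion ::
    "'a measure \<Rightarrow> (real \<Rightarrow> 'a measure) \<Rightarrow> (real \<Rightarrow> 'a \<Rightarrow> 'b::euclidean_space) \<Rightarrow> bool" where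
  "brownian_motion M G B \<longleftrightarrow>
     adapted G B \<and>
     (AE \<omega> in M. B 0 \<omega> = 0) \<and>
     (AE \<omega> in M. continuous_on {0..} (\<lambda>t. B t \<omega>)) \<and>
     (\<forall>s t. 0 \<le> s \<longrightarrow> s < t \<longrightarrow>
        prob_space.indep_set M (sets (G s))
          (sets (vimage_algebra (space M) (\<lambda>\<omega>. B t \<omega> - B s \<omega>) borel)) \<and>
        distributed M lborel (\<lambda>\<omega>. B t \<omega> - B s \<omega>)
          (\<lambda>x. ennreal (\<Prod>b\<in>Basis. normal_density 0 (sqrt (t - s)) (x \<bullet> b))))"

text \<open>The data \<open>N, s, \<xi>\<close> encode the simple integrand
  \<open>\<Sum>i<N. \<xi>\<^sub>i 1_{(s\<^sub>i, s\<^sub>i\<^sub>+\<^sub>1]}\<close> with bounded, \<open>G (s i)\<close>-measurable \<open>\<xi>\<^sub>i\<close>.\<close>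

definition simple_integrand ::
    "'a measure \<Rightarrow> (real \<Rightarrow> 'a measure) \<Rightarrow> nat \<Rightarrow> (nat \<Rightarrow> real) \<Rightarrow> (nat \<Rightarrow> 'a \<Rightarrow> real) \<Rightarrow> bool" where
  "simple_integrand M G N s \<xi> \<longleftrightarrow>
     (\<forall>i<N. 0 \<le> s i \<and> s i \<le> s (Suc i) \<and> \<xi> i \<in> borel_measurable (G (s i)) \<and>
        (\<exists>C. \<forall>\<omega>\<in>space M. \<bar>\<xi> i \<omega>\<bar> \<le> C))"

definition simple_value :: "nat \<Rightarrow> (nat \<Rightarrow> real) \<Rightarrow> (nat \<Rightarrow> 'a \<Rightarrow> real) \<Rightarrow> real \<Rightarrow> 'a \<Rightarrow> real" where
  "simple_value N s \<xi> u \<omega> = (\<Sum>i<N. \<xi> i \<omega> * indicator {s i<..s (Suc i)} u)"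

definition simple_integral ::
    "(real \<Rightarrow> 'a \<Rightarrow> real) \<Rightarrow> nat \<Rightarrow> (nat \<Rightarrow> real) \<Rightarrow> (nat \<Rightarrow> 'a \<Rightarrow> real) \<Rightarrow> real \<Rightarrow> 'a \<Rightarrow> real" where
  "simple_integral B N s \<xi> t \<omega> = (\<Sum>i<N. \<xi> i \<omega> * (B (min t (s (Suc i))) \<omega> - B (min t (s i)) \<omega>))"

definition tends_to_0_in_prob :: "'a measure \<Rightarrow> (nat \<Rightarrow> 'a \<Rightarrow> ennreal) \<Rightarrow> bool" where
  "tends_to_0_in_prob M X \<longleftrightarrow>
     (\<forall>\<epsilon>>0. (\<lambda>k. measure M {\<omega>\<in>space M. ennreal \<epsilon> < X k \<omega>}) \<longlonglongrightarrow> 0)"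

text \<open>\<open>I\<close> is (a version of) the process \<open>\<integral>\<^sub>0\<^sup>t H dB\<close>: the continuous adapted process that is
  the limit in probability of the integrals of simple integrands converging to \<open>H\<close> in
  \<open>L\<^sup>2([0,t])\<close> in probability, for every \<open>t\<close>. This determines \<open>I\<close> up to indistinguishability. The
  \<open>L\<^sup>2\<close> distance is a nonnegative integral, so \<open>\<integral>\<^sub>0\<^sup>t H\<^sup>2 ds < \<infinity>\<close> almost surely is part of the
  definition.\<close>

definition ito_integral ::
    "'a measure \<Rightarrow> (real \<Rightarrow> 'a measure) \<Rightarrow> (real \<Rightarrow> 'a \<Rightarrow> real) \<Rightarrow> (real \<Rightarrow> 'a \<Rightarrow> real) \<Rightarrow>
     (real \<Rightarrow> 'a \<Rightarrow> real) \<Rightarrow> bool" where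
  "ito_integral M G B H I \<longleftrightarrow>
     progressive G H \<and> adapted G I \<and>
     (AE \<omega> in M. continuous_on {0..} (\<lambda>t. I t \<omega>)) \<and>
     (\<exists>N s \<xi>. (\<forall>k. simple_integrand M G (N k) (s k) (\<xi> k)) \<and>
        (\<forall>t\<ge>0.
           tends_to_0_in_prob M (\<lambda>k \<omega>.
             \<integral>\<^sup>+u\<in>{0..t}. ennreal ((simple_value (N k) (s k) (\<xi> k) u \<omega> - H u \<omega>)\<^sup>2) \<partial>lborel) \<and>
           tends_to_0_in_prob M (\<lambda>k \<omega>.
             ennreal \<bar>simple_integral B (N k) (s k) (\<xi> k) t \<omega> - I t \<omega>\<bar>)))"


section \<open>The structural credit risk model\<close>

text \<open>Functions given only on a subset of the reals are extended by 0.\<close>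

definition zero_ext :: "real set \<Rightarrow> (real \<Rightarrow> 'b::zero) \<Rightarrow> real \<Rightarrow> 'b" where
  "zero_ext S f x = (if x \<in> S then f x else 0)"

text \<open>Continuous differentiability on \<open>S\<close>, with one-sided derivatives at boundary points;
  \<open>f\<close> is not constrained outside \<open>S\<close>.\<close>

definition C1_on :: "real set \<Rightarrow> (real \<Rightarrow> 'b::real_normed_vector) \<Rightarrow> bool" where
  "C1_on S f \<longleftrightarrow>
     (\<exists>f'. (\<forall>x\<in>S. (f has_vector_derivative f' x) (at x within S)) \<and> continuous_on S f')"

definition C2_on :: "real set \<Rightarrow> (real \<Rightarrow> 'b::real_normed_vector) \<Rightarrow> bool" where
  "C2_on S f \<longleftrightarrow>
     (\<exists>f'. (\<forall>x\<in>S. (f has_vector_derivative f' x) (at x within S)) \<and> C1_on S f')"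

text \<open>\<open>\<Sum>{n : t\<^sub>n \<le> t} \<delta>\<^sub>n (X\<^bsub>t\<^sub>n-\<^esub> - K)\<^sup>+\<close>; dividend dates are numbered from 1.\<close>

definition cum_dividends ::
    "(nat \<Rightarrow> real) \<Rightarrow> (nat \<Rightarrow> 'a \<Rightarrow> real) \<Rightarrow> real \<Rightarrow> (real \<Rightarrow> 'a \<Rightarrow> real) \<Rightarrow> real \<Rightarrow> 'a \<Rightarrow> real" where
  "cum_dividends td \<delta> K X t \<omega> =
     (\<Sum>n | 1 \<le> n \<and> td n \<le> t. \<delta> n \<omega> * max 0 (left_limit X (td n) \<omega> - K))"

definition default_time :: "real \<Rightarrow> (real \<Rightarrow> 'a \<Rightarrow> real) \<Rightarrow> 'a \<Rightarrow> ereal" where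
  "default_time K V \<omega> = Inf (ereal ` {t. 0 \<le> t \<and> V t \<omega> \<le> K})"

definition default_indicator :: "real \<Rightarrow> (real \<Rightarrow> 'a \<Rightarrow> real) \<Rightarrow> real \<Rightarrow> 'a \<Rightarrow> real" where
  "default_indicator K V t \<omega> = indicator {\<omega>. default_time K V \<omega> \<le> ereal t} \<omega>"

definition stopped_at_default :: "real \<Rightarrow> (real \<Rightarrow> 'a \<Rightarrow> real) \<Rightarrow> real \<Rightarrow> 'a \<Rightarrow> real" where
  "stopped_at_default K V t \<omega> = V (real_of_ereal (min (ereal t) (default_time K V \<omega>))) \<omega>"

definition observation ::
    "(real \<Rightarrow> real ^ 'l) \<Rightarrow> (real \<Rightarrow> 'a \<Rightarrow> real) \<Rightarrow> (real \<Rightarrow> 'a \<Rightarrow> real ^ 'l) \<Rightarrow> real \<Rightarrow> 'a \<Rightarrow> real ^ 'l" where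
  "observation a X W t \<omega> = (LINT s:{0..t}|lborel. zero_ext {0..} a (X s \<omega>)) + W t \<omega>"

locale structural_model = prob_space M
  for M :: "'a measure" +
  fixes G :: "real \<Rightarrow> 'a measure"
    and r \<sigma> K \<kappa> :: real
    and B :: "real \<Rightarrow> 'a \<Rightarrow> real"
    and W :: "real \<Rightarrow> 'a \<Rightarrow> real ^ 'l::finite"
    and td :: "nat \<Rightarrow> real"
    and \<delta> :: "nat \<Rightarrow> 'a \<Rightarrow> real"
    and \<phi> :: "real \<Rightarrow> real"
    and V :: "real \<Rightarrow> 'a \<Rightarrow> real"
    and \<pi>0 :: "real \<Rightarrow> real"
    and a :: "real \<Rightarrow> real ^ 'l"
  assumes filtration: "time_filtration M G"
    and constants: "0 \<le> r" "0 < \<sigma>" "0 < K" "\<kappa> \<in> {0, 1}"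
    and BM_B: "brownian_motion M G B"
    and BM_W: "brownian_motion M G W"
    and indep_W_B: "indep_set (sets (generated_sigma M {0..} W)) (sets (generated_sigma M {0..} B))"
    and dividend_dates: "0 < td 1" "\<And>n. 1 \<le> n \<Longrightarrow> td n < td (Suc n)"
      "\<exists>\<Delta>. \<forall>n\<ge>1. td (Suc n) - td n = \<Delta>"
    and \<delta>_range: "\<And>n \<omega>. 1 \<le> n \<Longrightarrow> \<omega> \<in> space M \<Longrightarrow> \<delta> n \<omega> \<in> {0<..<1}"
    and \<delta>_indep: "indep_vars (\<lambda>_. borel) \<delta> {1..}"
    and \<delta>_density: "\<And>n. 1 \<le> n \<Longrightarrow> distributed M lborel (\<delta> n) (\<lambda>x. ennreal (zero_ext {0..1} \<phi> x))"
    and \<phi>: "\<And>x. x \<in> {0..1} \<Longrightarrow> 0 \<le> \<phi> x" "bounded (\<phi> ` {0..1})" "C2_on {0..1} \<phi>" "\<phi> 1 = 0"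
    and \<delta>_measurable: "\<And>n. 1 \<le> n \<Longrightarrow> \<delta> n \<in> borel_measurable (G (td n))"
    and \<delta>_indep_past: "\<And>n. 1 \<le> n \<Longrightarrow>
      indep_set (sets (vimage_algebra (space M) (\<delta> n) borel)) (sets (left_sigma M G (td n)))"
    and V_adapted: "adapted G V"
    and V_cadlag: "cadlag M V"
    and V_equation: "\<exists>I. ito_integral M G B (\<lambda>s \<omega>. \<sigma> * V s \<omega>) I \<and>
      (AE \<omega> in M. \<forall>t\<ge>0. V t \<omega> =
         V 0 \<omega> + (LINT s:{0..t}|lborel. r * V s \<omega>) + I t \<omega> - \<kappa> * cum_dividends td \<delta> K V t \<omega>)"
    and V0_moment: "integrable M (\<lambda>\<omega>. (V 0 \<omega>)\<^sup>2)"
    and V0_density: "distributed M lborel (V 0) (\<lambda>x. ennreal (zero_ext {K..} \<pi>0 x))"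
    and \<pi>0: "\<And>x. K \<le> x \<Longrightarrow> 0 \<le> \<pi>0 x" "C1_on {K..} \<pi>0" "\<pi>0 K = 0"
    and a: "bounded (a ` {0..})" "C1_on {0..} a" "a K = 0"

definition model_filtration ::
    "'a measure \<Rightarrow> real \<Rightarrow> (real \<Rightarrow> 'a \<Rightarrow> real ^ 'l::finite) \<Rightarrow> (nat \<Rightarrow> real) \<Rightarrow> (nat \<Rightarrow> 'a \<Rightarrow> real) \<Rightarrow>
     (real \<Rightarrow> 'a \<Rightarrow> real) \<Rightarrow> (real \<Rightarrow> real ^ 'l) \<Rightarrow> real \<Rightarrow> 'a measure" where
  "model_filtration M K W td \<delta> V a t =
     sigma_join M (natural_filtration M (default_indicator K V) t)
       (sigma_join M (natural_filtration M (cum_dividends td \<delta> K V) t)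
          (natural_filtration M (observation a V W) t))"

definition stopped_filtration ::
    "'a measure \<Rightarrow> real \<Rightarrow> (real \<Rightarrow> 'a \<Rightarrow> real ^ 'l::finite) \<Rightarrow> (nat \<Rightarrow> real) \<Rightarrow> (nat \<Rightarrow> 'a \<Rightarrow> real) \<Rightarrow>
     (real \<Rightarrow> 'a \<Rightarrow> real) \<Rightarrow> (real \<Rightarrow> real ^ 'l) \<Rightarrow> real \<Rightarrow> 'a measure" where
  "stopped_filtration M K W td \<delta> V a t =
     sigma_join M (natural_filtration M (observation a (stopped_at_default K V) W) t)
       (natural_filtration M (cum_dividends td \<delta> K (stopped_at_default K V)) t)"

text \<open>Conditional expectations are taken on the completion of the probability space: without
  usual conditions the hitting time \<open>\<tau>\<close> need only be measurable with respect to the completed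
  sigma-algebra, and \<^const>\<open>real_cond_exp\<close> is meaningful only for sub-sigma-algebras of its
  underlying measure space. On a complete space nothing changes.\<close>

definition cond_expectation :: "'a measure \<Rightarrow> 'a measure \<Rightarrow> ('a \<Rightarrow> real) \<Rightarrow> 'a \<Rightarrow> real" where
  "cond_expectation M F X = real_cond_exp (completion M) F X"

definition cond_probability :: "'a measure \<Rightarrow> 'a measure \<Rightarrow> 'a set \<Rightarrow> 'a \<Rightarrow> real" where
  "cond_probability M F A = cond_expectation M F (indicator A)"

end

theory Submission
  imports Defs
begin

text \<open>On \<open>{\<tau> > t}\<close> the processes \<open>V\<close>, \<open>D\<close>, \<open>Z\<close> coincide up to time \<open>t\<close> with their stopped
  versions and \<open>Y\<close> vanishes, so the two sigma-algebras have the same trace on this event, which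
  belongs to the modelling filtration and equals \<open>{V\<^sup>\<tau>\<^sub>t > K}\<close>. For sigma-algebras with equal traces the
  quotient formula follows by testing against the events of the modelling filtration. The remaining
  point is the measurability of \<open>\<tau>\<close>: almost surely a path whose left limit is at most \<open>K\<close> is itself
  at most \<open>K\<close>, so \<open>\<tau> \<le> u\<close> can be read off from countably many values of \<open>V\<close>.\<close>

section \<open>Sigma-algebras with equal traces\<close>

text \<open>The quotient arises because the stopped filtration need not contain the survival event
  \<open>A\<close>; it knows \<open>A\<close> only through the conditional probability in the
  denominator. Nothing bounds the quotient itself, so the identity is tested with the denominator
  multiplied out, which keeps everything integrable; almost sure positivity of the denominator on
  \<open>A\<close> is added at the end. The obstacle with \<tau> is that a cadlag path may have
  infimum K on [0, u] without attaining it, by coming down to K from the left and jumping up.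
  Sampling at countably many times would then report a default that has not happened. The equation
  for \<open>V\<close> excludes such paths, but only outside a null set, so \<tau> is shown to be
  measurable for the completed sigma-algebra, and all conditional expectations are taken
  there.\<close>

lemma trace_sigma_sets:
  assumes "B \<in> sigma_sets \<Omega> S" "A \<subseteq> \<Omega>" "space F = \<Omega>"
    and "\<And>D. D \<in> S \<Longrightarrow> \<exists>C\<in>sets F. D \<inter> A = C \<inter> A"
  shows "\<exists>C\<in>sets F. B \<inter> A = C \<inter> A"
  using assms(1)
proof (induction rule: sigma_sets.induct)
  case (Basic D)
  then show ?case by (rule assms(4))
next
  case Empty
  show ?case by (intro bexI[of _ "{}"]) auto
next
  case (Compl D)
  then obtain C where C: "C \<in> sets F" "D \<inter> A = C \<inter> A" by blast
  have "(\<Omega> - D) \<inter> A = (space F - C) \<inter> A"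
    using C(2) assms(2,3) by blast
  then show ?case using C(1) by blast
next
  case (Union D)
  then obtain C where C: "\<And>i. C i \<in> sets F" "\<And>i::nat. D i \<inter> A = C i \<inter> A" by metis
  have "(\<Union>i. D i) \<inter> A = (\<Union>i. C i) \<inter> A"
    using C(2) by blast
  moreover have "(\<Union>i. C i) \<in> sets F"
    using C(1) by blast
  ultimately show ?case by blast
qed

section \<open>Generated sigma-algebras, joins and their traces\<close>

lemma space_generated_sigma [simp]: "space (generated_sigma M I X) = space M"
  unfolding generated_sigma_def by (rule space_measure_of) auto

lemma sets_generated_sigma:
  "sets (generated_sigma M I X) =
     sigma_sets (space M) {X i -` A \<inter> space M | i A. i \<in> I \<and> A \<in> sets borel}"
  unfolding generated_sigma_def by (rule sets_measure_of) auto

lemma space_sigma_join [simp]: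
  assumes "space F = space M" "space G = space M"
  shows "space (sigma_join M F G) = space M"
  unfolding sigma_join_def
  by (rule space_measure_of) (use assms sets.sets_into_space in blast)

lemma sets_sigma_join:
  assumes "space F = space M" "space G = space M"
  shows "sets (sigma_join M F G) = sigma_sets (space M) (sets F \<union> sets G)"
  unfolding sigma_join_def
  by (rule sets_measure_of) (use assms sets.sets_into_space in blast)

lemma subalgebra_generated_sigma:
  assumes "space N = space M" "\<And>i. i \<in> I \<Longrightarrow> X i \<in> borel_measurable N"
  shows "subalgebra N (generated_sigma M I X)"
proof -
  have "sigma_sets (space M) {X i -` A \<inter> space M | i A. i \<in> I \<and> A \<in> sets borel} \<subseteq> sets N"
    unfolding assms(1)[symmetric] using assms(2)
    by (intro sets.sigma_sets_subset) (auto intro: measurable_sets)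
  then show ?thesis
    by (simp add: subalgebra_def sets_generated_sigma assms(1))
qed

lemma subalgebra_sigma_join:
  assumes "space N = space M" "subalgebra N F" "subalgebra N G"
  shows "subalgebra N (sigma_join M F G)"
proof -
  have sp: "space F = space M" "space G = space M"
    using assms by (auto simp: subalgebra_def)
  have "sigma_sets (space M) (sets F \<union> sets G) \<subseteq> sets N"
    unfolding assms(1)[symmetric] using assms(2,3)
    by (intro sets.sigma_sets_subset) (auto simp: subalgebra_def)
  then show ?thesis
    by (simp add: subalgebra_def sets_sigma_join sp assms(1))
qed

lemma sets_sigma_join_upper:
  assumes "space F = space M" "space G = space M"
  shows "sets F \<subseteq> sets (sigma_join M F G)" "sets G \<subseteq> sets (sigma_join M F G)"
  using assms by (auto simp: sets_sigma_join)

lemma generated_sigmaI: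
  assumes "i \<in> I" "A \<in> sets borel"
  shows "X i -` A \<inter> space M \<in> sets (generated_sigma M I X)"
  unfolding sets_generated_sigma using assms by (intro sigma_sets.Basic) blast

lemma measurable_generated_sigma:
  fixes X :: "'i \<Rightarrow> 'a \<Rightarrow> 'b::topological_space"
  assumes "i \<in> I" "space H = space M" "sets (generated_sigma M I X) \<subseteq> sets H"
  shows "X i \<in> borel_measurable H"
proof (rule measurableI)
  fix A assume "A \<in> sets (borel :: 'b measure)"
  then show "X i -` A \<inter> space H \<in> sets H"
    unfolding assms(2) by (intro subsetD[OF assms(3)] generated_sigmaI assms(1))
qed simp

lemma trace_sigma_join:
  assumes "B \<in> sets (sigma_join M F G)" "A \<subseteq> space M"
    and "space F = space M" "space G = space M" "space H = space M"
    and "\<And>D. D \<in> sets F \<Longrightarrow> \<exists>C\<in>sets H. D \<inter> A = C \<inter> A"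
    and "\<And>D. D \<in> sets G \<Longrightarrow> \<exists>C\<in>sets H. D \<inter> A = C \<inter> A"
  shows "\<exists>C\<in>sets H. B \<inter> A = C \<inter> A"
  using assms by (intro trace_sigma_sets[of B "space M" "sets F \<union> sets G"]) (auto simp: sets_sigma_join)

text \<open>Preimages of one Borel set under two functions that coincide on \<open>A\<close> have
  the same trace on \<open>A\<close>. The family \<open>X'\<close> is free to choose: it will be the
  stopped or unstopped counterpart of \<open>X\<close>, or a constant when \<open>X\<close> is
  constant on \<open>A\<close>.\<close>

lemma trace_generated_sigma:
  assumes "B \<in> sets (generated_sigma M I X)" "A \<subseteq> space M" "space H = space M"
    and "\<And>i. i \<in> I \<Longrightarrow> X' i \<in> borel_measurable H"
    and "\<And>i \<omega>. i \<in> I \<Longrightarrow> \<omega> \<in> A \<Longrightarrow> X i \<omega> = X' i \<omega>"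
  shows "\<exists>C\<in>sets H. B \<inter> A = C \<inter> A"
proof (rule trace_sigma_sets)
  show "B \<in> sigma_sets (space M) {X i -` A \<inter> space M | i A. i \<in> I \<and> A \<in> sets borel}"
    using assms(1) by (simp add: sets_generated_sigma)
  fix D assume "D \<in> {X i -` A \<inter> space M | i A. i \<in> I \<and> A \<in> sets borel}"
  then obtain i S where D: "D = X i -` S \<inter> space M" "i \<in> I" "S \<in> sets borel" by blast
  have "D \<inter> A = (X' i -` S \<inter> space M) \<inter> A"
    using assms(5)[OF D(2)] by (auto simp: D(1))
  moreover have "X' i -` S \<inter> space M \<in> sets H"
    using measurable_sets[OF assms(4)[OF D(2)] D(3)] assms(3) by simp
  ultimately show "\<exists>C\<in>sets H. D \<inter> A = C \<inter> A" by blast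
qed (use assms in auto)

text \<open>Events of \<open>F\<close> and \<open>H\<close> are interchangeable under an integrand
  that carries the factor \<open>indicator A\<close>. \<open>trace_F\<close> turns a test event of
  \<open>F\<close> into one of \<open>H\<close>, where conditioning on \<open>H\<close> applies;
  \<open>trace_H\<close> makes \<open>indicator A\<close> times an \<open>H\<close>-measurable
  function measurable for \<open>F\<close>.\<close>

lemma (in finite_measure) cond_exp_equal_traces:
  fixes X :: "'a \<Rightarrow> real"
  assumes F: "subalgebra M F" and H: "subalgebra M H" and A: "A \<in> sets F"
    and trace_F: "\<And>B. B \<in> sets F \<Longrightarrow> \<exists>C\<in>sets H. B \<inter> A = C \<inter> A"
    and trace_H: "\<And>C. C \<in> sets H \<Longrightarrow> \<exists>B\<in>sets F. C \<inter> A = B \<inter> A"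
    and X: "integrable M X"
  shows "AE \<omega> in M. indicator A \<omega> * real_cond_exp M F X \<omega> =
    indicator A \<omega> * (real_cond_exp M H (\<lambda>\<omega>. X \<omega> * indicator A \<omega>) \<omega> / real_cond_exp M H (indicator A) \<omega>)"
proof -
  interpret F: finite_measure_subalgebra M F by unfold_locales (rule F)
  interpret H: finite_measure_subalgebra M H by unfold_locales (rule H)
  have space_H: "space H = space M"
    using H by (simp add: subalgebra_def)
  have A_M [measurable]: "A \<in> sets M"
    using A F by (auto simp: subalgebra_def)
  define XA where "XA = (\<lambda>\<omega>. X \<omega> * indicator A \<omega>)"
  define g where "g = real_cond_exp M H XA"
  define p where "p = real_cond_exp M H (indicator A)"
  have X_M [measurable]: "X \<in> borel_measurable M"
    using X by auto
  have g_H: "g \<in> borel_measurable H" and p_H: "p \<in> borel_measurable H"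
    by (simp_all add: g_def p_def)
  have [measurable]: "g \<in> borel_measurable M" "p \<in> borel_measurable M"
    by (simp_all add: g_def p_def)
  have XA: "integrable M XA"
    unfolding XA_def by (intro integrable_real_mult_indicator A_M X)
  have IA: "integrable M (indicator A :: 'a \<Rightarrow> real)"
    by (intro integrable_real_indicator A_M) (simp add: less_top[symmetric])
  have g_int: "integrable M g"
    unfolding g_def by (rule H.real_cond_exp_int(1)[OF XA])
  have p_bounds: "AE \<omega> in M. 0 \<le> p \<omega>" "AE \<omega> in M. p \<omega> \<le> 1"
    unfolding p_def
    by (intro H.real_cond_exp_ge_c H.real_cond_exp_le_c IA; simp split: split_indicator)+
  have restrict_mono: "sets (restrict_space H A) \<subseteq> sets (restrict_space F A)"
  proof
    fix D assume "D \<in> sets (restrict_space H A)"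
    then obtain C where C: "C \<in> sets H" "D = A \<inter> C"
      by (auto simp: sets_restrict_space)
    obtain B where "B \<in> sets F" "C \<inter> A = B \<inter> A"
      using trace_H[OF C(1)] by blast
    then show "D \<in> sets (restrict_space F A)"
      using C(2) by (auto simp: sets_restrict_space)
  qed
  \<comment> \<open>As \<open>A\<close> lies in \<open>F\<close>, measurability for the trace of
    \<open>F\<close> on \<open>A\<close> is enough, and that trace contains the one of
    \<open>H\<close>.\<close>
  have H_to_F: "(\<lambda>\<omega>. indicator A \<omega> * f \<omega>) \<in> borel_measurable F"
    if "f \<in> borel_measurable H" for f :: "'a \<Rightarrow> real"
  proof -
    have "f \<in> borel_measurable (restrict_space H A)"
      using that by (rule measurable_restrict_space1)
    moreover have "space (restrict_space H A) = space (restrict_space F A)"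
      using F H by (simp add: space_restrict_space subalgebra_def)
    ultimately have "f \<in> borel_measurable (restrict_space F A)"
      using restrict_mono by (auto simp: measurable_def)
    moreover have "A \<inter> space F \<in> sets F"
      using A by auto
    ultimately show ?thesis
      by (simp add: borel_measurable_restrict_space_iff)
  qed
  have Ap_F: "(\<lambda>\<omega>. indicator A \<omega> * p \<omega>) \<in> borel_measurable F"
    by (rule H_to_F[OF p_H])
  have Ag_F: "(\<lambda>\<omega>. indicator A \<omega> * g \<omega>) \<in> borel_measurable F"
    by (rule H_to_F[OF g_H])
  have pX: "integrable M (\<lambda>\<omega>. (indicator A \<omega> * p \<omega>) * X \<omega>)"
  proof (rule Bochner_Integration.integrable_bound[OF X])
    show "AE \<omega> in M. norm ((indicator A \<omega> * p \<omega>) * X \<omega>) \<le> norm (X \<omega>)"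
      using p_bounds
      by eventually_elim (auto simp: abs_mult split: split_indicator intro: mult_left_le_one_le)
  qed measurable
  have Ag: "integrable M (\<lambda>\<omega>. indicator A \<omega> * g \<omega>)"
    using integrable_real_mult_indicator[OF A_M g_int] by (simp add: mult.commute)
  have "AE \<omega> in M. real_cond_exp M F (\<lambda>\<omega>. (indicator A \<omega> * p \<omega>) * X \<omega>) \<omega> = indicator A \<omega> * g \<omega>"
  proof (rule F.real_cond_exp_charact[OF _ pX Ag Ag_F])
    fix B assume "B \<in> sets F"
    then obtain C where C: "C \<in> sets H" "B \<inter> A = C \<inter> A"
      using trace_F by blast
    have C_M: "C \<in> sets M"
      using C(1) H by (auto simp: subalgebra_def)
    have BC: "indicator B \<omega> * indicator A \<omega> = (indicator C \<omega> * indicator A \<omega> :: real)" for \<omega>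
      using C(2) by (auto simp: indicator_def)
    have Cp_H: "(\<lambda>\<omega>. indicator C \<omega> * p \<omega>) \<in> borel_measurable H"
      using C(1) p_H by measurable
    have Cg_H: "(\<lambda>\<omega>. indicator C \<omega> * g \<omega>) \<in> borel_measurable H"
      using C(1) g_H by measurable
    have CpX: "integrable M (\<lambda>\<omega>. (indicator C \<omega> * p \<omega>) * XA \<omega>)"
      using integrable_real_mult_indicator[OF C_M pX] by (simp add: XA_def ac_simps)
    have CgA: "integrable M (\<lambda>\<omega>. (indicator C \<omega> * g \<omega>) * indicator A \<omega>)"
      using integrable_real_mult_indicator[OF C_M Ag] by (simp add: ac_simps)
    \<comment> \<open>Conditioning on \<open>H\<close> is used in both directions: against the
      \<open>H\<close>-measurable factor \<open>indicator C * p\<close>, \<open>XA\<close> is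
      replaced by \<open>g\<close>; against \<open>indicator C * g\<close>, \<open>p\<close> is
      turned back into \<open>indicator A\<close>.\<close>
    have "(LINT \<omega>:B|M. (indicator A \<omega> * p \<omega>) * X \<omega>) = (\<integral>\<omega>. (indicator C \<omega> * p \<omega>) * XA \<omega> \<partial>M)"
      unfolding set_lebesgue_integral_def
    proof (intro Bochner_Integration.integral_cong refl)
      fix \<omega>
      show "indicator B \<omega> *\<^sub>R ((indicator A \<omega> * p \<omega>) * X \<omega>) = (indicator C \<omega> * p \<omega>) * XA \<omega>"
        using BC[of \<omega>] by (auto simp: XA_def indicator_def split: if_splits)
    qed
    also have "\<dots> = (\<integral>\<omega>. (indicator C \<omega> * p \<omega>) * g \<omega> \<partial>M)"
      unfolding g_def using CpX Cp_H XA by (intro H.real_cond_exp_intg(2)[symmetric]) auto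
    also have "\<dots> = (\<integral>\<omega>. (indicator C \<omega> * g \<omega>) * p \<omega> \<partial>M)"
      by (simp add: ac_simps)
    also have "\<dots> = (\<integral>\<omega>. (indicator C \<omega> * g \<omega>) * indicator A \<omega> \<partial>M)"
      unfolding p_def using CgA Cg_H by (intro H.real_cond_exp_intg(2)) auto
    also have "\<dots> = (LINT \<omega>:B|M. indicator A \<omega> * g \<omega>)"
      unfolding set_lebesgue_integral_def
    proof (intro Bochner_Integration.integral_cong refl)
      fix \<omega>
      show "(indicator C \<omega> * g \<omega>) * indicator A \<omega> = indicator B \<omega> *\<^sub>R (indicator A \<omega> * g \<omega>)"
        using BC[of \<omega>] by (auto simp: indicator_def split: if_splits)
    qed
    finally show "(LINT \<omega>:B|M. (indicator A \<omega> * p \<omega>) * X \<omega>) = (LINT \<omega>:B|M. indicator A \<omega> * g \<omega>)" .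
  qed
  moreover have "AE \<omega> in M. real_cond_exp M F (\<lambda>\<omega>. (indicator A \<omega> * p \<omega>) * X \<omega>) \<omega> =
      (indicator A \<omega> * p \<omega>) * real_cond_exp M F X \<omega>"
    by (rule F.real_cond_exp_mult[OF Ap_F X_M pX])
  moreover have "AE \<omega> in M. \<omega> \<in> A \<longrightarrow> p \<omega> \<noteq> 0"
  proof -
    \<comment> \<open>The zero set of \<open>p\<close> is an event of \<open>H\<close>, so the
      measure of \<open>Z \<inter> A\<close> is the integral of \<open>p\<close> over
      \<open>Z\<close>, which vanishes.\<close>
    define Z where "Z = {\<omega>\<in>space H. p \<omega> = 0}"
    have Z: "Z \<in> sets H"
      unfolding Z_def using p_H by measurable
    have Z_M [measurable]: "Z \<in> sets M"
      using Z H by (auto simp: subalgebra_def)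
    have "(\<integral>\<omega>. indicator Z \<omega> * indicator A \<omega> \<partial>M) = (\<integral>\<omega>. indicator Z \<omega> * p \<omega> \<partial>M)"
      unfolding p_def
      using Z integrable_real_mult_indicator[OF Z_M IA]
      by (intro H.real_cond_exp_intg(2)[symmetric]) (auto simp: ac_simps)
    also have "\<dots> = 0"
      by (rule integral_eq_zero_AE) (auto simp: Z_def indicator_def)
    finally have "measure M (Z \<inter> A) = 0"
      by (simp flip: indicator_inter_arith)
    then have "Z \<inter> A \<in> null_sets M"
      by (intro null_setsI) (simp_all add: emeasure_eq_measure)
    then have "AE \<omega> in M. \<omega> \<notin> Z \<inter> A"
      by (rule AE_not_in)
    then show ?thesis
      using AE_space by eventually_elim (auto simp: Z_def space_H)
  qed
  ultimately show ?thesis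
    unfolding g_def[symmetric] p_def[symmetric] XA_def[symmetric]
    by eventually_elim (auto simp: field_simps split: split_indicator)
qed

section \<open>Cadlag paths and the default time\<close>

text \<open>Compactness of the interval, by bisection, for a property stable under subsets and
  finite unions. The neighbourhoods are one-sided and omit their centre because a cadlag path is
  controlled separately to the left of a point, at it, and to its right.\<close>

lemma one_sided_interval_cover:
  fixes u :: real
  assumes "0 \<le> u"
    and union: "\<And>A B. P A \<Longrightarrow> P B \<Longrightarrow> P (A \<union> B)"
    and subset: "\<And>A B. P B \<Longrightarrow> A \<subseteq> B \<Longrightarrow> P A"
    and point: "\<And>x. 0 \<le> x \<Longrightarrow> x \<le> u \<Longrightarrow> P {x}"
    and right: "\<And>x. 0 \<le> x \<Longrightarrow> x \<le> u \<Longrightarrow> \<exists>b>x. P {x<..<b}"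
    and left: "\<And>x. 0 < x \<Longrightarrow> x \<le> u \<Longrightarrow> \<exists>c<x. P {c<..<x}"
  shows "P {0..u}"
proof -
  have "P ({0..u} \<inter> {0..u})"
  proof (rule Bolzano[OF assms(1), of "\<lambda>a b. P ({a..b} \<inter> {0..u})"])
    fix a b c :: real
    assume "P ({a..b} \<inter> {0..u})" "P ({b..c} \<inter> {0..u})"
    then have "P (({a..b} \<inter> {0..u}) \<union> ({b..c} \<inter> {0..u}))"
      by (rule union)
    then show "P ({a..c} \<inter> {0..u})"
      by (rule subset) auto
  next
    fix x assume x: "0 \<le> x" "x \<le> u"
    obtain b where b: "x < b" "P {x<..<b}"
      using right[OF x] by blast
    \<comment> \<open>At 0 no left neighbourhood is assumed; any negative \<open>c\<close> will do,
      since the intersection with \<open>{0..u}\<close> is then empty.\<close>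
    obtain c where c: "c < x" "P ({c<..<x} \<inter> {0..u})"
    proof (cases "x = 0")
      case True
      have "P ({-1<..<x} \<inter> {0..u})"
        using point[OF x] by (rule subset) (use True in auto)
      then show ?thesis
        using True by (intro that[of "-1"]) auto
    next
      case False
      then obtain c where "c < x" "P {c<..<x}"
        using left[of x] x by auto
      then show ?thesis
        using that subset[OF _ Int_lower1] by blast
    qed
    have P: "P ({x<..<b} \<union> (({c<..<x} \<inter> {0..u}) \<union> {x}))"
      by (intro union b(2) c(2) point[OF x])
    have "P ({a'..b'} \<inter> {0..u})" if "a' \<le> x" "x \<le> b'" "b' - a' < min (b - x) (x - c)" for a' b'
      using P by (rule subset) (use that in auto)
    then show "\<exists>d>0. \<forall>a b. a \<le> x \<and> x \<le> b \<and> b - a < d \<longrightarrow> P ({a..b} \<inter> {0..u})"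
      using b(1) c(1) by (intro exI[of _ "min (b - x) (x - c)"]) auto
  qed
  then show ?thesis by simp
qed

lemma cadlag_path_bounded:
  fixes f :: "real \<Rightarrow> real"
  assumes right: "\<And>x. 0 \<le> x \<Longrightarrow> (f \<longlongrightarrow> f x) (at_right x)"
    and left: "\<And>x. 0 < x \<Longrightarrow> \<exists>l. (f \<longlongrightarrow> l) (at_left x)"
    and "0 \<le> u"
  shows "\<exists>C. \<forall>x\<in>{0..u}. \<bar>f x\<bar> \<le> C"
proof -
  have bound: "\<exists>C. eventually (\<lambda>y. \<bar>f y\<bar> \<le> C) F" if "(f \<longlongrightarrow> l) F" for l F
  proof -
    have "eventually (\<lambda>y. \<bar>f y\<bar> < \<bar>l\<bar> + 1) F"
      using tendsto_rabs[OF that] by (rule order_tendstoD) simp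
    then show ?thesis
      by (auto elim: eventually_mono intro!: exI[of _ "\<bar>l\<bar> + 1"])
  qed
  show ?thesis
  proof (rule one_sided_interval_cover[OF assms(3), of "\<lambda>A. \<exists>C. \<forall>x\<in>A. \<bar>f x\<bar> \<le> C"])
    fix A B assume "\<exists>C. \<forall>x\<in>A. \<bar>f x\<bar> \<le> C" "\<exists>C. \<forall>x\<in>B. \<bar>f x\<bar> \<le> C"
    then obtain C D where CD: "\<forall>x\<in>A. \<bar>f x\<bar> \<le> C" "\<forall>x\<in>B. \<bar>f x\<bar> \<le> D" by blast
    then show "\<exists>C. \<forall>x\<in>A \<union> B. \<bar>f x\<bar> \<le> C"
      by (intro exI[of _ "max C D"]) (auto simp: le_max_iff_disj)
  next
    fix x :: real assume "0 \<le> x"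
    then obtain C where "eventually (\<lambda>y. \<bar>f y\<bar> \<le> C) (at_right x)"
      using bound right by blast
    then show "\<exists>b>x. \<exists>C. \<forall>y\<in>{x<..<b}. \<bar>f y\<bar> \<le> C"
      unfolding eventually_at_right_field by (metis greaterThanLessThan_iff)
  next
    fix x :: real assume "0 < x"
    then obtain C where "eventually (\<lambda>y. \<bar>f y\<bar> \<le> C) (at_left x)"
      using bound left by blast
    then show "\<exists>c<x. \<exists>C. \<forall>y\<in>{c<..<x}. \<bar>f y\<bar> \<le> C"
      unfolding eventually_at_left_field by (metis greaterThanLessThan_iff)
  qed (blast, auto)
qed

text \<open>Near each point the path stays above some level larger than \<open>K\<close>, and
  finitely many such levels have a minimum. The condition on left limits is what prevents the
  infimum from being \<open>K\<close> without being attained.\<close>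

lemma uniformly_above_on_interval:
  fixes f :: "real \<Rightarrow> real"
  assumes right: "\<And>x. 0 \<le> x \<Longrightarrow> (f \<longlongrightarrow> f x) (at_right x)"
    and left: "\<And>x. 0 < x \<Longrightarrow> x \<le> u \<Longrightarrow> \<exists>l>K. (f \<longlongrightarrow> l) (at_left x)"
    and above: "\<And>x. 0 \<le> x \<Longrightarrow> x \<le> u \<Longrightarrow> K < f x"
    and "0 \<le> u"
  shows "\<exists>c>K. \<forall>x\<in>{0..u}. c \<le> f x"
proof -
  have bound: "\<exists>c>K. eventually (\<lambda>y. c \<le> f y) F" if "(f \<longlongrightarrow> l) F" "K < l" for l F
  proof -
    obtain c where "K < c" "c < l"
      using dense[OF \<open>K < l\<close>] by blast
    then show ?thesis
      using order_tendstoD(1)[OF that(1)] by (blast intro: eventually_mono less_imp_le)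
  qed
  show ?thesis
  proof (rule one_sided_interval_cover[OF assms(4), of "\<lambda>A. \<exists>c>K. \<forall>x\<in>A. c \<le> f x"])
    fix A B assume "\<exists>c>K. \<forall>x\<in>A. c \<le> f x" "\<exists>c>K. \<forall>x\<in>B. c \<le> f x"
    then obtain C D where CD: "K < C" "K < D" "\<forall>x\<in>A. C \<le> f x" "\<forall>x\<in>B. D \<le> f x" by blast
    then show "\<exists>c>K. \<forall>x\<in>A \<union> B. c \<le> f x"
      by (intro exI[of _ "min C D"]) (auto simp: min_le_iff_disj)
  next
    fix x assume x: "0 \<le> x" "x \<le> u"
    then show "\<exists>c>K. \<forall>y\<in>{x}. c \<le> f y"
      using above by auto
    obtain c where "K < c" "eventually (\<lambda>y. c \<le> f y) (at_right x)"
      using bound[OF right[OF x(1)] above[OF x]] by blast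
    then show "\<exists>b>x. \<exists>c>K. \<forall>y\<in>{x<..<b}. c \<le> f y"
      unfolding eventually_at_right_field by (metis greaterThanLessThan_iff)
  next
    fix x assume "0 < x" "x \<le> u"
    then obtain c where "K < c" "eventually (\<lambda>y. c \<le> f y) (at_left x)"
      using bound left by blast
    then show "\<exists>c<x. \<exists>d>K. \<forall>y\<in>{c<..<x}. d \<le> f y"
      unfolding eventually_at_left_field by (metis greaterThanLessThan_iff)
  qed blast
qed

text \<open>Right continuity carries a value at most \<open>K\<close> to nearby later rationals,
  where it is only approximately at most \<open>K\<close>; hence the thresholds
  \<open>K + 1 / real (Suc n)\<close>. Conversely, a path that never reaches \<open>K\<close> keeps
  a positive distance from it, which a large \<open>n\<close> detects.\<close>

lemma hitting_rational_iff:
  fixes f :: "real \<Rightarrow> real"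
  assumes right: "\<And>x. 0 \<le> x \<Longrightarrow> (f \<longlongrightarrow> f x) (at_right x)"
    and left: "\<And>x. 0 < x \<Longrightarrow> \<exists>l. (f \<longlongrightarrow> l) (at_left x) \<and> (l \<le> K \<longrightarrow> f x \<le> K)"
    and "0 \<le> u"
  shows "(\<exists>x\<in>{0..u}. f x \<le> K) \<longleftrightarrow>
    (\<forall>n::nat. \<exists>q\<in>insert u ({0..u} \<inter> \<rat>). f q < K + 1 / real (Suc n))"
proof
  assume "\<exists>x\<in>{0..u}. f x \<le> K"
  then obtain x where x: "0 \<le> x" "x \<le> u" "f x \<le> K" by auto
  show "\<forall>n::nat. \<exists>q\<in>insert u ({0..u} \<inter> \<rat>). f q < K + 1 / real (Suc n)"
  proof
    fix n :: nat
    have lt: "f x < K + 1 / real (Suc n)"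
      by (rule le_less_trans[OF x(3)]) simp
    show "\<exists>q\<in>insert u ({0..u} \<inter> \<rat>). f q < K + 1 / real (Suc n)"
    \<comment> \<open>A hit at the right end point has no later time in the interval to witness it,
      which is why \<open>u\<close> is among the sample times.\<close>
    proof (cases "x = u")
      case True
      then show ?thesis using lt by blast
    next
      case False
      obtain b where b: "x < b" "\<And>y. x < y \<Longrightarrow> y < b \<Longrightarrow> f y < K + 1 / real (Suc n)"
        using order_tendstoD(2)[OF right[OF x(1)] lt] by (auto simp: eventually_at_right_field)
      obtain q where "q \<in> \<rat>" "x < q" "q < min b u"
        using Rats_dense_in_real[of x "min b u"] b(1) x(2) False by auto
      then show ?thesis using b(2)[of q] x(1) by auto
    qed
  qed
next
  assume R: "\<forall>n::nat. \<exists>q\<in>insert u ({0..u} \<inter> \<rat>). f q < K + 1 / real (Suc n)"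
  show "\<exists>x\<in>{0..u}. f x \<le> K"
  proof (rule ccontr)
    assume "\<not> ?thesis"
    then have above: "K < f x" if "0 \<le> x" "x \<le> u" for x
      using that by force
    have "\<exists>l>K. (f \<longlongrightarrow> l) (at_left x)" if "0 < x" "x \<le> u" for x
      using left[OF that(1)] above[of x] that by (meson less_imp_le not_le)
    then obtain c where c: "K < c" "\<And>x. x \<in> {0..u} \<Longrightarrow> c \<le> f x"
      using uniformly_above_on_interval[of f u K, OF right _ above assms(3)] by blast
    obtain n :: nat where n: "1 / real (Suc n) < c - K"
      using nat_approx_posE[of "c - K"] c(1) by auto
    obtain q where "q \<in> insert u ({0..u} \<inter> \<rat>)" "f q < K + 1 / real (Suc n)"
      using R by blast
    then show False using c(2)[of q] n assms(3) by auto
  qed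
qed

section \<open>The default time and the stopped path\<close>

lemma default_time_gtD:
  assumes "ereal t < default_time K V \<omega>" "0 \<le> s" "s \<le> t"
  shows "K < V s \<omega>"
proof (rule ccontr)
  assume "\<not> K < V s \<omega>"
  then have "default_time K V \<omega> \<le> ereal s"
    unfolding default_time_def using assms(2) by (intro Inf_lower) auto
  also have "ereal s \<le> ereal t"
    using assms(3) by simp
  finally show False using assms(1) by simp
qed

text \<open>If the path were above \<open>K\<close> at the infimum of the hitting times, right
  continuity would keep it above \<open>K\<close> for a while longer, contradicting the choice of
  the infimum. The bound \<open>le\<close> excludes the empty set, whose infimum is
  \<infinity>.\<close>

lemma default_time_attained:
  assumes right: "\<And>s. 0 \<le> s \<Longrightarrow> ((\<lambda>s. V s \<omega>) \<longlongrightarrow> V s \<omega>) (at_right s)"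
    and le: "default_time K V \<omega> \<le> ereal t"
  shows "\<exists>u\<in>{0..t}. default_time K V \<omega> = ereal u \<and> V u \<omega> \<le> K"
proof -
  define S where "S = {t. 0 \<le> t \<and> V t \<omega> \<le> K}"
  have ne: "S \<noteq> {}"
    using le unfolding default_time_def S_def[symmetric] by (auto simp: top_ereal_def)
  have bdd: "bdd_below S"
    unfolding S_def by (rule bdd_belowI[of _ 0]) simp
  have tau: "default_time K V \<omega> = ereal (Inf S)"
    unfolding default_time_def S_def[symmetric] by (rule ereal_Inf'[OF bdd ne, symmetric])
  have nonneg: "0 \<le> Inf S"
    by (rule cInf_greatest[OF ne]) (simp add: S_def)
  have "V (Inf S) \<omega> \<le> K"
  proof (rule ccontr)
    assume "\<not> ?thesis"
    then have K: "K < V (Inf S) \<omega>" by simp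
    obtain b where b: "Inf S < b" "\<And>y. Inf S < y \<Longrightarrow> y < b \<Longrightarrow> K < V y \<omega>"
      using order_tendstoD(1)[OF right[OF nonneg] K] unfolding eventually_at_right_field by blast
    obtain y where "y \<in> S" "y < b"
      using cInf_lessD[OF ne b(1)] by blast
    then show False
      using b(2)[of y] K cInf_lower[OF _ bdd, of y] by (cases "y = Inf S") (auto simp: S_def)
  qed
  then show ?thesis
    using tau le nonneg by auto
qed

lemma default_time_le_iff:
  assumes right: "\<And>s. 0 \<le> s \<Longrightarrow> ((\<lambda>s. V s \<omega>) \<longlongrightarrow> V s \<omega>) (at_right s)"
  shows "default_time K V \<omega> \<le> ereal t \<longleftrightarrow> (\<exists>u\<in>{0..t}. V u \<omega> \<le> K)"
proof
  assume "default_time K V \<omega> \<le> ereal t"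
  then show "\<exists>u\<in>{0..t}. V u \<omega> \<le> K"
    using default_time_attained[of V \<omega> K t, OF right] by blast
next
  assume "\<exists>u\<in>{0..t}. V u \<omega> \<le> K"
  then obtain u where "0 \<le> u" "u \<le> t" "V u \<omega> \<le> K" by auto
  then show "default_time K V \<omega> \<le> ereal t"
    using default_time_gtD[of t K V \<omega> u] by (meson not_le)
qed

lemma default_time_nonneg: "0 \<le> default_time K V \<omega>"
  unfolding default_time_def by (rule Inf_greatest) auto

lemma stopped_before_default:
  assumes "ereal t \<le> default_time K V \<omega>"
  shows "stopped_at_default K V t \<omega> = V t \<omega>"
  using assms by (simp add: stopped_at_default_def min_absorb1)

lemma stopped_after_default:
  assumes "default_time K V \<omega> = ereal u" "u \<le> t"
  shows "stopped_at_default K V t \<omega> = V u \<omega>"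
  using assms by (simp add: stopped_at_default_def min_absorb2)

text \<open>From default on, the stopped path is frozen at its value at the default time, and this
  value is at most \<open>K\<close> because the default time is attained.\<close>

lemma stopped_above_iff:
  assumes right: "\<And>s. 0 \<le> s \<Longrightarrow> ((\<lambda>s. V s \<omega>) \<longlongrightarrow> V s \<omega>) (at_right s)"
    and "0 \<le> t"
  shows "K < stopped_at_default K V t \<omega> \<longleftrightarrow> ereal t < default_time K V \<omega>"
proof (cases "ereal t < default_time K V \<omega>")
  case True
  then show ?thesis
    using default_time_gtD[OF True, of t] assms(2) by (simp add: stopped_before_default)
next
  case False
  then obtain u where "u \<in> {0..t}" "default_time K V \<omega> = ereal u" "V u \<omega> \<le> K"
    using default_time_attained[of V \<omega> K t, OF right] by (auto simp: not_less)
  then show ?thesis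
    using False by (simp add: stopped_after_default)
qed

text \<open>\<open>left_limit\<close> is a \<open>Lim\<close>, hence meaningful only where the path
  converges. Left of \<open>s\<close> the stopped path is either still \<open>V\<close> or already
  constant.\<close>

lemma stopped_left_limit_exists:
  assumes left: "0 < s" "((\<lambda>s. V s \<omega>) \<longlongrightarrow> l) (at_left s)"
  shows "\<exists>l. ((\<lambda>s. stopped_at_default K V s \<omega>) \<longlongrightarrow> l) (at_left s)"
proof (cases "ereal s \<le> default_time K V \<omega>")
  case True
  have "eventually (\<lambda>x. stopped_at_default K V x \<omega> = V x \<omega>) (at_left s)"
    using eventually_at_left_real[OF left(1)]
  proof eventually_elim
    fix x assume "x \<in> {0<..<s}"
    then have "ereal x \<le> ereal s" by simp
    then show "stopped_at_default K V x \<omega> = V x \<omega>"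
      using True by (intro stopped_before_default) (rule order.trans)
  qed
  from tendsto_cong[OF this, of l] left(2) show ?thesis
    by blast
next
  case False
  then obtain u where u: "default_time K V \<omega> = ereal u" "u < s"
    using default_time_nonneg[of K V \<omega>] by (cases "default_time K V \<omega>") auto
  have "eventually (\<lambda>x. x \<in> {u<..<s}) (at_left s)"
    using u(2) by (rule eventually_at_left_real)
  then have "eventually (\<lambda>x. stopped_at_default K V x \<omega> = V u \<omega>) (at_left s)"
    by eventually_elim (auto intro: stopped_after_default[OF u(1)])
  then show ?thesis
    by (intro exI) (rule tendsto_eventually)
qed

text \<open>Paths that agree just before \<open>s\<close> have the same set of limits there, so
  \<open>Lim\<close> selects the same value whether or not they converge.\<close>

lemma left_limit_cong:
  assumes "0 < s" "\<And>x. 0 \<le> x \<Longrightarrow> x < s \<Longrightarrow> X x \<omega> = Y x \<omega>"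
  shows "left_limit X s \<omega> = left_limit Y s \<omega>"
proof -
  have "eventually (\<lambda>x. X x \<omega> = Y x \<omega>) (at_left s)"
    using eventually_at_left_real[OF assms(1)] by eventually_elim (use assms(2) in auto)
  from tendsto_cong[OF this] show ?thesis
    unfolding left_limit_def t2_space_class.Lim_def by simp
qed

lemma left_limit_eqI:
  assumes "((\<lambda>s. X s \<omega>) \<longlongrightarrow> l) (at_left s)"
  shows "left_limit X s \<omega> = l"
  unfolding left_limit_def using assms by (intro tendsto_Lim) simp_all

section \<open>Measurability\<close>

text \<open>Joint measurability of a right-continuous process, stated for a measurable time
  \<open>u\<close> and a measurable outcome \<open>p\<close>. This one form serves a single path as
  a function of time (constant \<open>p\<close>), evaluation on the product space, and evaluation at
  a random time.\<close>

lemma right_continuous_compose_measurable: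
  fixes X :: "real \<Rightarrow> 'a \<Rightarrow> real"
  assumes X: "\<And>s. 0 \<le> s \<Longrightarrow> X s \<in> borel_measurable N"
    and right: "\<And>\<omega> s. \<omega> \<in> space N \<Longrightarrow> 0 \<le> s \<Longrightarrow> ((\<lambda>s. X s \<omega>) \<longlongrightarrow> X s \<omega>) (at_right s)"
    and u [measurable]: "u \<in> borel_measurable L" and p: "p \<in> measurable L N"
  shows "(\<lambda>x. X (max 0 (u x)) (p x)) \<in> borel_measurable L"
proof (rule borel_measurable_LIMSEQ_real)
  \<comment> \<open>The time is rounded up to the grid of mesh \<open>1 / real (Suc n)\<close>:
    countably many values, and strictly to the right of the time, as \<open>at_right\<close> omits
    the point itself.\<close>
  define v where "v n x = (real (nat \<lfloor>max 0 (u x) * real (Suc n)\<rfloor>) + 1) / real (Suc n)" for n x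
  show "(\<lambda>x. X (v n x) (p x)) \<in> borel_measurable L" for n
  proof -
    have "(\<lambda>x. X ((real i + 1) / real (Suc n)) (p x)) \<in> borel_measurable L" for i :: nat
      using p X by (rule measurable_compose) simp
    moreover have "(\<lambda>x. nat \<lfloor>max 0 (u x) * real (Suc n)\<rfloor>) \<in> measurable L (count_space UNIV)"
      by measurable
    ultimately show ?thesis
      unfolding v_def by (rule measurable_compose_countable)
  qed
  fix x assume x: "x \<in> space L"
  define s where "s = max 0 (u x)"
  have v: "s < v n x" "v n x \<le> s + 1 / real (Suc n)" for n
  proof -
    have k: "real (nat \<lfloor>s * real (Suc n)\<rfloor>) = of_int \<lfloor>s * real (Suc n)\<rfloor>"
      by (rule of_nat_nat) (simp add: s_def)
    have "s * real (Suc n) < real (nat \<lfloor>s * real (Suc n)\<rfloor>) + 1"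
      unfolding k by (rule real_of_int_floor_add_one_gt)
    then show "s < v n x"
      unfolding v_def s_def[symmetric] by (simp add: pos_less_divide_eq del: of_nat_Suc)
    have "real (nat \<lfloor>s * real (Suc n)\<rfloor>) + 1 \<le> s * real (Suc n) + 1"
      unfolding k by simp
    then have "v n x \<le> (s * real (Suc n) + 1) / real (Suc n)"
      unfolding v_def s_def[symmetric] by (intro divide_right_mono) auto
    then show "v n x \<le> s + 1 / real (Suc n)"
      by (simp add: add_divide_distrib del: of_nat_Suc)
  qed
  have "(\<lambda>n. v n x) \<longlonglongrightarrow> s"
  proof (rule tendsto_sandwich[where f = "\<lambda>_. s" and h = "\<lambda>n. s + 1 / real (Suc n)"])
    show "(\<lambda>n. s + 1 / real (Suc n)) \<longlonglongrightarrow> s"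
      using tendsto_add[OF tendsto_const LIMSEQ_inverse_real_of_nat, of s] by (simp add: inverse_eq_divide)
  qed (use v in \<open>auto intro!: always_eventually less_imp_le simp del: of_nat_Suc\<close>)
  then have "filterlim (\<lambda>n. v n x) (at_right s) sequentially"
    using v(1) by (auto intro: tendsto_imp_filterlim_at_right)
  moreover have "((\<lambda>s. X s (p x)) \<longlongrightarrow> X s (p x)) (at_right s)"
    using measurable_space[OF p x] by (rule right) (simp add: s_def)
  ultimately show "(\<lambda>n. X (v n x) (p x)) \<longlonglongrightarrow> X (max 0 (u x)) (p x)"
    unfolding s_def[symmetric] by (rule filterlim_compose[rotated])
qed

lemma left_limit_measurable:
  fixes X :: "real \<Rightarrow> 'a \<Rightarrow> real"
  assumes X: "\<And>s. 0 \<le> s \<Longrightarrow> X s \<in> borel_measurable N" and t: "0 < t"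
    and left: "\<And>\<omega>. \<omega> \<in> space N \<Longrightarrow> \<exists>l. ((\<lambda>s. X s \<omega>) \<longlongrightarrow> l) (at_left t)"
  shows "left_limit X t \<in> borel_measurable N"
proof (rule borel_measurable_LIMSEQ_real)
  \<comment> \<open>Scaling the step by \<open>t\<close> makes the sequence start at 0, so no
    negative time is sampled.\<close>
  define v where "v n = t - t / real (Suc n)" for n
  have v_nonneg: "0 \<le> v n" for n
    using t by (simp add: v_def field_simps)
  show "X (v n) \<in> borel_measurable N" for n
    using X v_nonneg by blast
  fix \<omega> assume "\<omega> \<in> space N"
  then obtain l where l: "((\<lambda>s. X s \<omega>) \<longlongrightarrow> l) (at_left t)"
    using left by blast
  have "v \<longlonglongrightarrow> t"
    using tendsto_diff[OF tendsto_const tendsto_mult[OF tendsto_const LIMSEQ_inverse_real_of_nat], of t t]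
    by (simp add: v_def[abs_def] inverse_eq_divide)
  then have "filterlim v (at_left t) sequentially"
    using t by (intro tendsto_imp_filterlim_at_left) (auto simp: v_def)
  then show "(\<lambda>n. X (v n) \<omega>) \<longlonglongrightarrow> left_limit X t \<omega>"
    unfolding left_limit_eqI[where X = X, OF l] by (rule filterlim_compose[OF l])
qed

lemma cum_dividends_measurable:
  assumes "\<And>s. 0 \<le> s \<Longrightarrow> X s \<in> borel_measurable N"
    and "\<And>s \<omega>. 0 < s \<Longrightarrow> \<omega> \<in> space N \<Longrightarrow> \<exists>l. ((\<lambda>s. X s \<omega>) \<longlongrightarrow> l) (at_left s)"
    and "\<And>n. 1 \<le> n \<Longrightarrow> 0 < td n" "\<And>n. 1 \<le> n \<Longrightarrow> \<delta> n \<in> borel_measurable N"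
  shows "cum_dividends td \<delta> K X t \<in> borel_measurable N"
  unfolding cum_dividends_def[abs_def]
proof (rule borel_measurable_sum)
  fix n assume "n \<in> {n. 1 \<le> n \<and> td n \<le> t}"
  then have "1 \<le> n" by simp
  then have [measurable]: "\<delta> n \<in> borel_measurable N" "left_limit X (td n) \<in> borel_measurable N"
    using assms by (auto intro: left_limit_measurable)
  show "(\<lambda>\<omega>. \<delta> n \<omega> * max 0 (left_limit X (td n) \<omega> - K)) \<in> borel_measurable N"
    by measurable
qed

text \<open>A parameter integral of a jointly measurable integrand. Processes are unconstrained at
  negative times, so joint measurability is available only after \<open>max 0\<close>, which the
  indicator of \<open>{0..t}\<close> makes invisible.\<close>

lemma observation_measurable:
  fixes a :: "real \<Rightarrow> real ^ 'l::finite"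
  assumes X: "(\<lambda>p. X (max 0 (snd p)) (fst p)) \<in> borel_measurable (N \<Otimes>\<^sub>M borel)"
    and a: "continuous_on {0..} a" and W [measurable]: "W t \<in> borel_measurable N"
  shows "observation a X W t \<in> borel_measurable N"
proof -
  have "(\<lambda>x. indicator {0..} x *\<^sub>R a x) \<in> borel_measurable borel"
    using a by (intro borel_measurable_continuous_on_indicator) auto
  moreover have "(\<lambda>x. indicator {0..} x *\<^sub>R a x) = zero_ext {0..} a"
    by (auto simp: zero_ext_def indicator_def fun_eq_iff)
  ultimately have a' [measurable]: "zero_ext {0..} a \<in> borel_measurable borel"
    by simp
  have [measurable]: "(\<lambda>(\<omega>, s). X (max 0 s) \<omega>) \<in> borel_measurable (N \<Otimes>\<^sub>M lborel)"
  proof -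
    have "sets (N \<Otimes>\<^sub>M borel) = sets (N \<Otimes>\<^sub>M lborel)"
      by (intro sets_pair_measure_cong) auto
    then show ?thesis
      using X by (simp add: split_beta' cong: measurable_cong_sets)
  qed
  have "(\<lambda>(\<omega>, s). indicator {0..t} s *\<^sub>R zero_ext {0..} a (X (max 0 s) \<omega>)) \<in> borel_measurable (N \<Otimes>\<^sub>M lborel)"
    by measurable
  then have "(\<lambda>\<omega>. \<integral>s. indicator {0..t} s *\<^sub>R zero_ext {0..} a (X (max 0 s) \<omega>) \<partial>lborel) \<in> borel_measurable N"
    by (rule lborel.borel_measurable_lebesgue_integral)
  moreover have "observation a X W t =
      (\<lambda>\<omega>. (\<integral>s. indicator {0..t} s *\<^sub>R zero_ext {0..} a (X (max 0 s) \<omega>) \<partial>lborel) + W t \<omega>)"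
    unfolding observation_def set_lebesgue_integral_def
    by (intro ext arg_cong2[where f = "(+)"] Bochner_Integration.integral_cong) (auto simp: indicator_def)
  ultimately show ?thesis
    by simp
qed

text \<open>The Lebesgue integral agrees with the gauge integral, whose indefinite integral is
  continuous. This makes the interest term of the asset equation free of jumps.\<close>

lemma set_integral_tendsto_left:
  fixes f :: "real \<Rightarrow> real"
  assumes f: "set_integrable lborel {0..u} f" and u: "0 < u"
  shows "((\<lambda>s. LINT x:{0..s}|lborel. f x) \<longlongrightarrow> (LINT x:{0..u}|lborel. f x)) (at_left u)"
proof -
  have eq: "(LINT x:{0..s}|lborel. f x) = integral {0..s} f" if "s \<le> u" for s
    using that by (intro set_borel_integral_eq_integral(2) set_integrable_subset[OF f]) auto
  have "f integrable_on {0..u}"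
    using f by (rule set_borel_integral_eq_integral(1))
  then have "continuous_on {0..u} (\<lambda>s. integral {0..s} f)"
    by (rule indefinite_integral_continuous_1)
  then have "((\<lambda>s. integral {0..s} f) \<longlongrightarrow> integral {0..u} f) (at u within {0..u})"
    using u by (simp add: continuous_on_def)
  then have "((\<lambda>s. integral {0..s} f) \<longlongrightarrow> integral {0..u} f) (at_left u)"
    using u by (simp add: at_within_Icc_at_left)
  moreover have "eventually (\<lambda>s. integral {0..s} f = (LINT x:{0..s}|lborel. f x)) (at_left u)"
    using eventually_at_left_real[OF u] by eventually_elim (simp add: eq)
  ultimately show ?thesis
    using eq[of u] by (simp add: Lim_transform_eventually)
qed

section \<open>Dividend jumps and default in the model\<close>

context structural_model
begin

lemma V_measurable: "0 \<le> s \<Longrightarrow> V s \<in> borel_measurable M"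
  by (rule measurable_from_subalg[of _ "G s"])
    (use V_adapted filtration in \<open>simp_all add: adapted_def time_filtration_def\<close>)

lemma W_measurable: "0 \<le> s \<Longrightarrow> W s \<in> borel_measurable M"
  by (rule measurable_from_subalg[of _ "G s"])
    (use BM_W filtration in \<open>simp_all add: brownian_motion_def adapted_def time_filtration_def\<close>)

lemma V_right: "\<omega> \<in> space M \<Longrightarrow> 0 \<le> s \<Longrightarrow> ((\<lambda>s. V s \<omega>) \<longlongrightarrow> V s \<omega>) (at_right s)"
  using V_cadlag by (simp add: cadlag_def)

lemma V_left: "\<omega> \<in> space M \<Longrightarrow> 0 < s \<Longrightarrow> \<exists>l. ((\<lambda>s. V s \<omega>) \<longlongrightarrow> l) (at_left s)"
  using V_cadlag by (simp add: cadlag_def)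

lemma V_left_limit: "\<omega> \<in> space M \<Longrightarrow> 0 < s \<Longrightarrow> ((\<lambda>s. V s \<omega>) \<longlongrightarrow> left_limit V s \<omega>) (at_left s)"
  using V_left left_limit_eqI[of V] by metis

lemma dividend_dates_arithmetic:
  "\<exists>\<Delta>>0. \<forall>n. td (Suc n) = td 1 + real n * \<Delta>"
proof -
  obtain \<Delta> where \<Delta>: "\<And>n. 1 \<le> n \<Longrightarrow> td (Suc n) - td n = \<Delta>"
    using dividend_dates(3) by blast
  have "td (Suc n) = td 1 + real n * \<Delta>" for n
  proof (induction n)
    case (Suc n)
    then show ?case using \<Delta>[of "Suc n"] by (simp add: algebra_simps)
  qed simp
  moreover have "0 < \<Delta>"
    using \<Delta>[of 1] dividend_dates(2)[of 1] by simp
  ultimately show ?thesis by blast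
qed

lemma dividend_dates_pos: "1 \<le> n \<Longrightarrow> 0 < td n"
proof -
  assume n: "1 \<le> n"
  obtain \<Delta> where \<Delta>: "0 < \<Delta>" "\<forall>n. td (Suc n) = td 1 + real n * \<Delta>"
    using dividend_dates_arithmetic by (elim exE conjE) (rule that)
  obtain k where k: "n = Suc k"
    using n by (cases n) auto
  have "td n = td 1 + real k * \<Delta>"
    unfolding k by (rule \<Delta>(2)[rule_format])
  then show "0 < td n"
    using dividend_dates(1) \<Delta>(1) by (simp add: add_pos_nonneg)
qed

text \<open>Equidistant dates with positive spacing are unbounded. Finiteness matters because a sum
  over an infinite index set is 0 by convention, which would falsify
  \<open>cum_dividends\<close>.\<close>

lemma finite_dividend_dates: "finite {n. 1 \<le> n \<and> td n \<le> u}"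
proof -
  obtain \<Delta> where \<Delta>: "0 < \<Delta>" "\<forall>n. td (Suc n) = td 1 + real n * \<Delta>"
    using dividend_dates_arithmetic by (elim exE conjE) (rule that)
  obtain N :: nat where N: "(u - td 1) / \<Delta> < real N"
    using reals_Archimedean2 by blast
  have "{n. 1 \<le> n \<and> td n \<le> u} \<subseteq> {..N}"
  proof
    fix n assume "n \<in> {n. 1 \<le> n \<and> td n \<le> u}"
    then obtain k where n: "n = Suc k" and "td (Suc k) \<le> u"
      by (cases n) auto
    from this(2) have k: "td 1 + real k * \<Delta> \<le> u"
      by (rule ord_eq_le_trans[OF \<Delta>(2)[rule_format, symmetric]])
    have "real k \<le> (u - td 1) / \<Delta>"
      using k \<Delta>(1) by (simp add: pos_le_divide_eq)
    then show "n \<in> {..N}"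
      using N n by simp
  qed
  then show ?thesis
    using finite_subset by blast
qed

text \<open>Only finitely many dates precede \<open>u\<close>, so the total is constant just before
  \<open>u\<close> and differs from its value at \<open>u\<close> by what is paid at
  \<open>u\<close>. The subtracted sum is empty when \<open>u\<close> is no dividend date.\<close>

lemma cum_dividends_jump:
  "((\<lambda>s. cum_dividends td \<delta> K X s \<omega>) \<longlongrightarrow> cum_dividends td \<delta> K X u \<omega> -
     (\<Sum>n | 1 \<le> n \<and> td n = u. \<delta> n \<omega> * max 0 (left_limit X u \<omega> - K))) (at_left u)"
proof -
  define d where "d n = \<delta> n \<omega> * max 0 (left_limit X (td n) \<omega> - K)" for n
  have fin: "finite {n. 1 \<le> n \<and> td n < u}" "finite {n. 1 \<le> n \<and> td n = u}"
    by (rule finite_subset[OF _ finite_dividend_dates[of u]]; auto)+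
  have "{n. 1 \<le> n \<and> td n \<le> u} = {n. 1 \<le> n \<and> td n < u} \<union> {n. 1 \<le> n \<and> td n = u}"
    by auto
  then have "cum_dividends td \<delta> K X u \<omega> = sum d {n. 1 \<le> n \<and> td n < u} + sum d {n. 1 \<le> n \<and> td n = u}"
    unfolding cum_dividends_def d_def[symmetric] using fin by (simp add: sum.union_disjoint disjoint_iff)
  moreover have "sum d {n. 1 \<le> n \<and> td n = u} =
      (\<Sum>n | 1 \<le> n \<and> td n = u. \<delta> n \<omega> * max 0 (left_limit X u \<omega> - K))"
    by (intro sum.cong) (auto simp: d_def)
  moreover have "eventually (\<lambda>s. cum_dividends td \<delta> K X s \<omega> = sum d {n. 1 \<le> n \<and> td n < u}) (at_left u)"
  proof -
    have "eventually (\<lambda>s. td n \<le> s) (at_left u)" if "td n < u" for n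
      using eventually_at_left_real[OF that] by eventually_elim auto
    then have "eventually (\<lambda>s. \<forall>n\<in>{n. 1 \<le> n \<and> td n < u}. td n \<le> s) (at_left u)"
      using fin(1) by (intro eventually_ball_finite) auto
    moreover have "eventually (\<lambda>s. s < u) (at_left u)"
      by (simp add: eventually_at_filter)
    ultimately show ?thesis
    proof eventually_elim
      fix s assume "\<forall>n\<in>{n. 1 \<le> n \<and> td n < u}. td n \<le> s" "s < u"
      then have "{n. 1 \<le> n \<and> td n \<le> s} = {n. 1 \<le> n \<and> td n < u}"
        by auto
      then show "cum_dividends td \<delta> K X s \<omega> = sum d {n. 1 \<le> n \<and> td n < u}"
        by (simp add: cum_dividends_def d_def)
    qed
  qed
  ultimately show ?thesis
    by (simp add: tendsto_eventually)
qed

lemma V_path_integrable: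
  assumes \<omega>: "\<omega> \<in> space M" and "0 \<le> u"
  shows "set_integrable lborel {0..u} (\<lambda>s. V s \<omega>)"
proof -
  obtain C where C: "\<And>s. s \<in> {0..u} \<Longrightarrow> \<bar>V s \<omega>\<bar> \<le> C"
    using cadlag_path_bounded[of "\<lambda>s. V s \<omega>" u] V_right[OF \<omega>] V_left[OF \<omega>] assms(2) by blast
  \<comment> \<open>Here time is the variable and the outcome is held fixed.\<close>
  have "(\<lambda>s. V (max 0 (id s)) \<omega>) \<in> borel_measurable borel"
    by (rule right_continuous_compose_measurable[of V M])
      (use V_measurable V_right \<omega> in auto)
  then have "integrable lborel (\<lambda>s. indicator {0..u} s *\<^sub>R V (max 0 s) \<omega>)"
    using C by (intro integrableI_bounded_set_indicator[where B = C]) (auto simp: emeasure_lborel_Icc_eq)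
  moreover have "(\<lambda>s. indicator {0..u} s *\<^sub>R V (max 0 s) \<omega>) = (\<lambda>s. indicator {0..u} s *\<^sub>R V s \<omega>)"
    by (auto simp: indicator_def fun_eq_iff)
  ultimately show ?thesis
    by (simp add: set_integrable_def)
qed

text \<open>The driving terms are continuous, and a dividend is paid only if \<open>V\<close> is above \<open>K\<close> just
  before; hence \<open>V\<close> cannot approach the default boundary from the left without defaulting.\<close>

lemma AE_no_jump_below_K: "AE \<omega> in M. \<forall>u>0. left_limit V u \<omega> \<le> K \<longrightarrow> V u \<omega> \<le> K"
proof -
  obtain I where I: "ito_integral M G B (\<lambda>s \<omega>. \<sigma> * V s \<omega>) I"
    and eq: "AE \<omega> in M. \<forall>t\<ge>0. V t \<omega> =
         V 0 \<omega> + (LINT s:{0..t}|lborel. r * V s \<omega>) + I t \<omega> - \<kappa> * cum_dividends td \<delta> K V t \<omega>"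
    using V_equation by blast
  have "AE \<omega> in M. continuous_on {0..} (\<lambda>t. I t \<omega>)"
    using I by (simp add: ito_integral_def)
  with eq AE_space show ?thesis
  proof eventually_elim
    fix \<omega>
    assume \<omega>: "\<omega> \<in> space M" and cont: "continuous_on {0..} (\<lambda>t. I t \<omega>)"
      and eq: "\<forall>t\<ge>0. V t \<omega> =
         V 0 \<omega> + (LINT s:{0..t}|lborel. r * V s \<omega>) + I t \<omega> - \<kappa> * cum_dividends td \<delta> K V t \<omega>"
    show "\<forall>u>0. left_limit V u \<omega> \<le> K \<longrightarrow> V u \<omega> \<le> K"
    proof (intro allI impI)
      fix u :: real assume u: "0 < u" and below: "left_limit V u \<omega> \<le> K"
      define rhs where "rhs D t = V 0 \<omega> + (LINT s:{0..t}|lborel. r * V s \<omega>) + I t \<omega> - \<kappa> * D" for D t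
      have "continuous_on {0..u} (\<lambda>t. I t \<omega>)"
        using cont by (rule continuous_on_subset) auto
      then have "((\<lambda>t. I t \<omega>) \<longlongrightarrow> I u \<omega>) (at u within {0..u})"
        using u by (simp add: continuous_on_def)
      then have I_left: "((\<lambda>t. I t \<omega>) \<longlongrightarrow> I u \<omega>) (at_left u)"
        using u by (simp add: at_within_Icc_at_left)
      have "set_integrable lborel {0..u} (\<lambda>s. r * V s \<omega>)"
        using V_path_integrable[OF \<omega>, of u] u by simp
      note int_left = set_integral_tendsto_left[OF this u]
      \<comment> \<open>Even if \<open>u\<close> is a dividend date, the positive part in the jump
        is 0 by \<open>below\<close>.\<close>
      have D_left: "((\<lambda>s. cum_dividends td \<delta> K V s \<omega>) \<longlongrightarrow> cum_dividends td \<delta> K V u \<omega>) (at_left u)"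
        using cum_dividends_jump[of V \<omega> u] below by simp
      have "((\<lambda>t. rhs (cum_dividends td \<delta> K V t \<omega>) t) \<longlongrightarrow> rhs (cum_dividends td \<delta> K V u \<omega>) u) (at_left u)"
        unfolding rhs_def by (intro tendsto_intros I_left int_left D_left)
      moreover have "eventually (\<lambda>t. rhs (cum_dividends td \<delta> K V t \<omega>) t = V t \<omega>) (at_left u)"
        using eventually_at_left_real[OF u]
      proof eventually_elim
        fix t assume "t \<in> {0<..<u}"
        then show "rhs (cum_dividends td \<delta> K V t \<omega>) t = V t \<omega>"
          unfolding rhs_def using eq[rule_format, of t] by simp
      qed
      moreover have "rhs (cum_dividends td \<delta> K V u \<omega>) u = V u \<omega>"
        unfolding rhs_def using eq[rule_format, of u] u by simp
      ultimately have "((\<lambda>t. V t \<omega>) \<longlongrightarrow> V u \<omega>) (at_left u)"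
        by (simp add: Lim_transform_eventually)
      then have "left_limit V u \<omega> = V u \<omega>"
        by (rule left_limit_eqI)
      then show "V u \<omega> \<le> K"
        using below by simp
    qed
  qed
qed

text \<open>The event \<open>R\<close> built from countably many sample times lies in
  \<open>M\<close> and agrees with the default event off a null set; the completion absorbs the
  difference.\<close>

lemma default_time_le_sets: "{\<omega>\<in>space M. default_time K V \<omega> \<le> ereal u} \<in> sets (completion M)"
proof (cases "0 \<le> u")
  case False
  then have "{\<omega>\<in>space M. default_time K V \<omega> \<le> ereal u} = {}"
    using order.trans[OF default_time_nonneg, of K V _ "ereal u"] by auto
  then show ?thesis by (metis sets.empty_sets)
next
  case True
  define Q where "Q = insert u ({0..u} \<inter> \<rat>)"
  define R where "R = {\<omega>\<in>space M. \<forall>n::nat. \<exists>q\<in>Q. V q \<omega> < K + 1 / real (Suc n)}"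
  have "countable Q"
    unfolding Q_def using countable_rat by blast
  moreover have "{\<omega>\<in>space M. V q \<omega> < c} \<in> sets M" if "q \<in> Q" for q c
  proof -
    have "V q \<in> borel_measurable M"
      using that True by (intro V_measurable) (auto simp: Q_def)
    then show ?thesis by measurable
  qed
  ultimately have "R \<in> sets M"
    unfolding R_def by (intro sets.sets_Collect_countable_All sets.sets_Collect_countable_Ex') auto
  then have R: "R \<in> sets (completion M)"
    by simp
  have ae: "AE \<omega> in completion M. \<omega> \<in> R \<longleftrightarrow> \<omega> \<in> {\<omega>\<in>space M. default_time K V \<omega> \<le> ereal u}"
  proof (rule AE_completion)
    show "AE \<omega> in M. \<omega> \<in> R \<longleftrightarrow> \<omega> \<in> {\<omega>\<in>space M. default_time K V \<omega> \<le> ereal u}"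
      using AE_no_jump_below_K AE_space
    proof eventually_elim
      fix \<omega> assume \<omega>: "\<omega> \<in> space M" and jump: "\<forall>u>0. left_limit V u \<omega> \<le> K \<longrightarrow> V u \<omega> \<le> K"
      have "default_time K V \<omega> \<le> ereal u \<longleftrightarrow> (\<exists>x\<in>{0..u}. V x \<omega> \<le> K)"
        using V_right[OF \<omega>] by (rule default_time_le_iff)
      also have "\<dots> \<longleftrightarrow> (\<forall>n::nat. \<exists>q\<in>Q. V q \<omega> < K + 1 / real (Suc n))"
        unfolding Q_def
      proof (rule hitting_rational_iff)
        show "\<exists>l. ((\<lambda>s. V s \<omega>) \<longlongrightarrow> l) (at_left x) \<and> (l \<le> K \<longrightarrow> V x \<omega> \<le> K)" if "0 < x" for x
          using V_left_limit[OF \<omega> that] jump that by blast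
      qed (use V_right[OF \<omega>] True in auto)
      finally show "\<omega> \<in> R \<longleftrightarrow> \<omega> \<in> {\<omega>\<in>space M. default_time K V \<omega> \<le> ereal u}"
        using \<omega> by (simp add: R_def)
    qed
  qed
  show ?thesis
    by (rule completion.in_sets_AE[OF ae R]) auto
qed

lemma default_time_measurable [measurable]: "default_time K V \<in> borel_measurable (completion M)"
  unfolding borel_measurable_iff_Iic_ereal
proof
  fix x :: ereal
  show "default_time K V -` {..x} \<inter> space (completion M) \<in> sets (completion M)"
  proof (cases x)
    case (real u)
    then show ?thesis
      using default_time_le_sets[of u] by (simp add: vimage_def Int_def conj_commute)
  next
    case PInf
    then have "default_time K V -` {..x} = UNIV" by auto
    then show ?thesis
      by (metis Int_UNIV_left sets.top)
  next
    case MInf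
    have "default_time K V \<omega> \<noteq> -\<infinity>" for \<omega>
      using default_time_nonneg[of K V \<omega>] by auto
    then show ?thesis
      using MInf by (simp add: vimage_def)
  qed
qed

section \<open>Measurability of the stopped process and of the observations\<close>

lemma V_compose_measurable:
  "u \<in> borel_measurable L \<Longrightarrow> p \<in> measurable L (completion M) \<Longrightarrow>
    (\<lambda>x. V (max 0 (u x)) (p x)) \<in> borel_measurable L"
  by (rule right_continuous_compose_measurable[of V "completion M"])
    (use V_right in \<open>auto intro: measurable_completion V_measurable\<close>)

text \<open>Stopping is evaluation of \<open>V\<close> at the random time
  \<open>min t \<tau>\<close>, so right continuity suffices once \<tau> is measurable. The added
  outer \<open>max 0\<close> changes nothing, as this time is nonnegative.\<close>

lemma stopped_compose_measurable:
  assumes [measurable]: "u \<in> borel_measurable L" "p \<in> measurable L (completion M)"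
  shows "(\<lambda>x. stopped_at_default K V (max 0 (u x)) (p x)) \<in> borel_measurable L"
proof -
  have "(\<lambda>x. V (max 0 (real_of_ereal (min (ereal (max 0 (u x))) (default_time K V (p x))))) (p x))
      \<in> borel_measurable L"
    by (rule V_compose_measurable) measurable
  moreover have "max 0 (real_of_ereal (min (ereal (max 0 (u x))) (default_time K V (p x)))) =
      real_of_ereal (min (ereal (max 0 (u x))) (default_time K V (p x)))" for x
    using default_time_nonneg[of K V "p x"] by (intro max_absorb2 real_of_ereal_pos) (simp del: ereal_max)
  ultimately show ?thesis
    by (simp add: stopped_at_default_def)
qed

lemma stopped_measurable: "0 \<le> s \<Longrightarrow> stopped_at_default K V s \<in> borel_measurable (completion M)"
  using stopped_compose_measurable[of "\<lambda>_. s" "completion M" "\<lambda>x. x"] by simp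

lemma a_continuous: "continuous_on {0..} a"
  using a(2) unfolding C1_on_def continuous_on_eq_continuous_within
  by (blast intro: has_vector_derivative_continuous)

lemma \<delta>_completion_measurable: "1 \<le> n \<Longrightarrow> \<delta> n \<in> borel_measurable (completion M)"
  using distributed_measurable[OF \<delta>_density[of n]] by (simp add: measurable_completion)

lemma observation_V_measurable: "0 \<le> s \<Longrightarrow> observation a V W s \<in> borel_measurable (completion M)"
  by (intro observation_measurable a_continuous measurable_completion W_measurable
      V_compose_measurable[where u = snd and p = fst]) simp_all

lemma observation_stopped_measurable:
  "0 \<le> s \<Longrightarrow> observation a (stopped_at_default K V) W s \<in> borel_measurable (completion M)"
  by (intro observation_measurable a_continuous measurable_completion W_measurable
      stopped_compose_measurable[where u = snd and p = fst]) simp_all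

lemma dividends_V_measurable: "cum_dividends td \<delta> K V s \<in> borel_measurable (completion M)"
  using V_left
  by (intro cum_dividends_measurable measurable_completion V_measurable dividend_dates_pos
      \<delta>_completion_measurable) auto

lemma dividends_stopped_measurable:
  "cum_dividends td \<delta> K (stopped_at_default K V) s \<in> borel_measurable (completion M)"
proof (intro cum_dividends_measurable stopped_measurable dividend_dates_pos \<delta>_completion_measurable)
  fix s :: real and \<omega> assume "0 < s" "\<omega> \<in> space (completion M)"
  then show "\<exists>l. ((\<lambda>s. stopped_at_default K V s \<omega>) \<longlongrightarrow> l) (at_left s)"
    by (intro stopped_left_limit_exists[OF _ V_left_limit]) simp_all
qed

lemma default_indicator_measurable: "default_indicator K V s \<in> borel_measurable (completion M)"
  unfolding default_indicator_def[abs_def] by measurable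

lemma subalgebra_model_filtration: "subalgebra (completion M) (model_filtration M K W td \<delta> V a t)"
  unfolding model_filtration_def
  by (intro subalgebra_sigma_join subalgebra_generated_sigma observation_V_measurable
      dividends_V_measurable default_indicator_measurable) auto

lemma subalgebra_stopped_filtration: "subalgebra (completion M) (stopped_filtration M K W td \<delta> V a t)"
  unfolding stopped_filtration_def
  by (intro subalgebra_sigma_join subalgebra_generated_sigma observation_stopped_measurable
      dividends_stopped_measurable) auto

end

section \<open>The filter formula\<close>

theorem proposition4p1:
  fixes M :: "'a measure" and G :: "real \<Rightarrow> 'a measure"
    and T r \<sigma> K \<kappa> :: real
    and B :: "real \<Rightarrow> 'a \<Rightarrow> real"
    and W :: "real \<Rightarrow> 'a \<Rightarrow> real ^ 'l::finite"
    and td :: "nat \<Rightarrow> real" and \<delta> :: "nat \<Rightarrow> 'a \<Rightarrow> real"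
    and \<phi> \<pi>0 :: "real \<Rightarrow> real"
    and V :: "real \<Rightarrow> 'a \<Rightarrow> real"
    and a :: "real \<Rightarrow> real ^ 'l"
    and h :: "real \<Rightarrow> real" and t :: real
  assumes "structural_model M G r \<sigma> K \<kappa> B W td \<delta> \<phi> V \<pi>0 a"
    and "0 < T"
    and "h \<in> borel_measurable (restrict_space borel {K..})"
    and "\<And>s. 0 \<le> s \<Longrightarrow> s \<le> T \<Longrightarrow> integrable M (\<lambda>\<omega>. zero_ext {K..} h (V s \<omega>))"
    and "0 \<le> t" and "t \<le> T"
  shows "AE \<omega> in completion M.
    indicator {\<omega>. ereal t < default_time K V \<omega>} \<omega> *
      cond_expectation M (model_filtration M K W td \<delta> V a t) (\<lambda>\<omega>. zero_ext {K..} h (V t \<omega>)) \<omega> =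
    indicator {\<omega>. ereal t < default_time K V \<omega>} \<omega> *
      (cond_expectation M (stopped_filtration M K W td \<delta> V a t)
         (\<lambda>\<omega>. zero_ext {K..} h (stopped_at_default K V t \<omega>) *
              indicator {\<omega>. K < stopped_at_default K V t \<omega>} \<omega>) \<omega> /
       cond_probability M (stopped_filtration M K W td \<delta> V a t)
         {\<omega>\<in>space M. K < stopped_at_default K V t \<omega>} \<omega>)"
proof -
  interpret structural_model M G r \<sigma> K \<kappa> B W td \<delta> \<phi> V \<pi>0 a by fact
  interpret completion: prob_space "completion M" by (rule prob_space_completion)
  define S where "S = stopped_at_default K V"
  define FM where "FM = model_filtration M K W td \<delta> V a t"
  define FS where "FS = stopped_filtration M K W td \<delta> V a t"
  define X where "X = (\<lambda>\<omega>. zero_ext {K..} h (V t \<omega>))"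
  define A where "A = {\<omega>\<in>space M. ereal t < default_time K V \<omega>}"
  have FM: "subalgebra (completion M) FM" and FS: "subalgebra (completion M) FS"
    unfolding FM_def FS_def
    by (rule subalgebra_model_filtration subalgebra_stopped_filtration)+
  have A_space: "A \<subseteq> space M"
    by (auto simp: A_def)
  have space_FS: "space FS = space M" and space_FM: "space FM = space M"
    using FM FS by (simp_all add: subalgebra_def)
  have X: "integrable (completion M) X"
    using assms(4)[of t] assms(5,6)
    by (subst integrable_completion) (auto simp: X_def)
  have before_default: "ereal s < default_time K V \<omega>" if "\<omega> \<in> A" "s \<le> t" for s \<omega>
    using that by (auto simp: A_def intro: le_less_trans[of "ereal s" "ereal t"])
  have S_eq_V: "S s \<omega> = V s \<omega>" if "\<omega> \<in> A" "s \<le> t" for s \<omega>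
    unfolding S_def by (rule stopped_before_default[OF less_imp_le[OF before_default[OF that]]])
  have A_eq: "A = {\<omega>\<in>space M. K < S t \<omega>}"
    using stopped_above_iff[of V _ t K, OF V_right] assms(5) by (auto simp: A_def S_def)
  have Y_eq: "default_indicator K V s \<omega> = 0" if "\<omega> \<in> A" "s \<le> t" for s \<omega>
    using before_default[OF that] by (simp add: default_indicator_def)
  \<comment> \<open>A dividend at \<open>td n\<close> depends on the path only through times before
    \<open>td n\<close>, hence before \<open>t\<close>, where both paths coincide on
    \<open>A\<close>.\<close>
  have D_eq: "cum_dividends td \<delta> K S s \<omega> = cum_dividends td \<delta> K V s \<omega>" if "\<omega> \<in> A" "s \<le> t" for s \<omega>
  proof -
    have "left_limit S (td n) \<omega> = left_limit V (td n) \<omega>" if "1 \<le> n" "td n \<le> s" for n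
      using S_eq_V \<open>\<omega> \<in> A\<close> \<open>s \<le> t\<close> that by (intro left_limit_cong dividend_dates_pos) auto
    then show ?thesis
      unfolding cum_dividends_def by (intro sum.cong) auto
  qed
  have Z_eq: "observation a S W s \<omega> = observation a V W s \<omega>" if "\<omega> \<in> A" "s \<le> t" for s \<omega>
    unfolding observation_def using S_eq_V that
    by (intro arg_cong2[where f = "(+)"] set_lebesgue_integral_cong refl) auto
  have sub_FM: "sets (natural_filtration M (default_indicator K V) t) \<subseteq> sets FM"
    "sets (natural_filtration M (cum_dividends td \<delta> K V) t) \<subseteq> sets FM"
    "sets (natural_filtration M (observation a V W) t) \<subseteq> sets FM"
    unfolding FM_def model_filtration_def
    by (simp_all add: sets_sigma_join_upper order.trans[OF _ sets_sigma_join_upper(2)])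
  have sub_FS: "sets (natural_filtration M (cum_dividends td \<delta> K S) t) \<subseteq> sets FS"
    "sets (natural_filtration M (observation a S W) t) \<subseteq> sets FS"
    unfolding FS_def stopped_filtration_def S_def by (simp_all add: sets_sigma_join_upper)
  have A_FM: "A \<in> sets FM"
  proof -
    have "A = default_indicator K V t -` {0} \<inter> space M"
      by (auto simp: A_def default_indicator_def indicator_def not_le)
    also have "\<dots> \<in> sets (natural_filtration M (default_indicator K V) t)"
      using assms(5) by (intro generated_sigmaI) auto
    finally show ?thesis
      by (rule subsetD[OF sub_FM(1)])
  qed
  note D_FM = measurable_generated_sigma[OF _ space_FM sub_FM(2)]
    and Z_FM = measurable_generated_sigma[OF _ space_FM sub_FM(3)]
    and D_FS = measurable_generated_sigma[OF _ space_FS sub_FS(1)]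
    and Z_FS = measurable_generated_sigma[OF _ space_FS sub_FS(2)]
  have "AE \<omega> in completion M. indicator A \<omega> * real_cond_exp (completion M) FM X \<omega> =
    indicator A \<omega> * (real_cond_exp (completion M) FS (\<lambda>\<omega>. X \<omega> * indicator A \<omega>) \<omega> /
      real_cond_exp (completion M) FS (indicator A) \<omega>)"
  proof (rule completion.cond_exp_equal_traces[OF FM FS A_FM _ _ X])
    fix D assume "D \<in> sets FM"
    then show "\<exists>C\<in>sets FS. D \<inter> A = C \<inter> A"
      unfolding FM_def model_filtration_def
    proof (rule trace_sigma_join[OF _ A_space])
      fix D assume "D \<in> sets (natural_filtration M (default_indicator K V) t)"
      then show "\<exists>C\<in>sets FS. D \<inter> A = C \<inter> A"
        \<comment> \<open>On \<open>A\<close> the default indicator is constantly 0 up to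
          \<open>t\<close>, so its counterpart is a constant, measurable for every
          sigma-algebra.\<close>
        by (rule trace_generated_sigma[OF _ A_space space_FS, where X' = "\<lambda>_ _. 0"]) (auto simp: Y_eq)
    next
      fix D assume "D \<in> sets (sigma_join M (natural_filtration M (cum_dividends td \<delta> K V) t)
          (natural_filtration M (observation a V W) t))"
      then show "\<exists>C\<in>sets FS. D \<inter> A = C \<inter> A"
      proof (rule trace_sigma_join[OF _ A_space])
        fix D assume "D \<in> sets (natural_filtration M (cum_dividends td \<delta> K V) t)"
        then show "\<exists>C\<in>sets FS. D \<inter> A = C \<inter> A"
          by (rule trace_generated_sigma[OF _ A_space space_FS, where X' = "cum_dividends td \<delta> K S"])
            (auto simp: D_eq D_FS)
      next
        fix D assume "D \<in> sets (natural_filtration M (observation a V W) t)"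
        then show "\<exists>C\<in>sets FS. D \<inter> A = C \<inter> A"
          by (rule trace_generated_sigma[OF _ A_space space_FS, where X' = "observation a S W"])
            (auto simp: Z_eq Z_FS)
      qed (simp_all add: space_FS)
    qed (simp_all add: space_FS)
  next
    fix C assume "C \<in> sets FS"
    then show "\<exists>D\<in>sets FM. C \<inter> A = D \<inter> A"
      unfolding FS_def stopped_filtration_def S_def[symmetric]
    proof (rule trace_sigma_join[OF _ A_space])
      fix D assume "D \<in> sets (natural_filtration M (cum_dividends td \<delta> K S) t)"
      then show "\<exists>C\<in>sets FM. D \<inter> A = C \<inter> A"
        by (rule trace_generated_sigma[OF _ A_space space_FM, where X' = "cum_dividends td \<delta> K V"])
          (auto simp: D_eq D_FM)
    next
      fix D assume "D \<in> sets (natural_filtration M (observation a S W) t)"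
      then show "\<exists>C\<in>sets FM. D \<inter> A = C \<inter> A"
        by (rule trace_generated_sigma[OF _ A_space space_FM, where X' = "observation a V W"])
          (auto simp: Z_eq Z_FM)
    qed (simp_all add: space_FM)
  qed
  moreover have "AE \<omega> in completion M. real_cond_exp (completion M) FS (\<lambda>\<omega>. X \<omega> * indicator A \<omega>) \<omega> =
      real_cond_exp (completion M) FS (\<lambda>\<omega>. zero_ext {K..} h (S t \<omega>) * indicator {\<omega>. K < S t \<omega>} \<omega>) \<omega>"
  proof -
    interpret FS: finite_measure_subalgebra "completion M" FS by unfold_locales (rule FS)
    \<comment> \<open>On \<open>A\<close> the values \<open>V t \<omega>\<close> and
      \<open>S t \<omega>\<close> agree, and off \<open>A\<close> both products are 0. The
      restriction to the space is needed because the indicator on the right ranges over the whole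
      type, unlike \<open>A\<close>.\<close>
    have eq: "X \<omega> * indicator A \<omega> = zero_ext {K..} h (S t \<omega>) * indicator {\<omega>. K < S t \<omega>} \<omega>"
      if "\<omega> \<in> space (completion M)" for \<omega>
    proof (cases "\<omega> \<in> A")
      case True
      then show ?thesis
        using S_eq_V[of \<omega> t] by (simp add: X_def A_eq)
    next
      case False
      then show ?thesis
        using that by (simp add: A_eq)
    qed
    have "A \<in> sets (completion M)"
      using A_FM FM by (auto simp: subalgebra_def)
    then have XA: "(\<lambda>\<omega>. X \<omega> * indicator A \<omega>) \<in> borel_measurable (completion M)"
      using X by measurable
    show ?thesis
    proof (rule FS.real_cond_exp_cong[OF AE_I2[OF eq] XA])
      show "(\<lambda>\<omega>. zero_ext {K..} h (S t \<omega>) * indicator {\<omega>. K < S t \<omega>} \<omega>) \<in> borel_measurable (completion M)"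
        using XA by (rule measurable_cong[THEN iffD1, rotated]) (rule eq)
    qed
  qed
  ultimately show ?thesis
    using AE_space unfolding cond_expectation_def cond_probability_def
      FM_def[symmetric] FS_def[symmetric] S_def[symmetric] X_def[symmetric] A_eq[symmetric]
    by eventually_elim (simp add: A_def indicator_def)
qed

end
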